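(* Let $X$ be a nonempty set. The strong bimonoid $\mathsf{M}(X)=\mathsf{B}_{\mathrm{id,rd}}[X]/{\sim_L}$, i.e. the quotient of the idempotent right-distributive strong bimonoid $\mathsf{B}_{\mathrm{id,rd}}[X]=(\mathbb{B}_{\mathrm{id,rd}}[X],+_{\mathrm{id}},\times_{\mathrm{rd}},0,1)$ of id-reduced polynomials by the congruence $\sim_L$ that identifies all large polynomials, is idempotent, right-distributive, weakly locally finite, and not locally finite.
   Context: A strong bimonoid is an algebra $(B,\oplus,\otimes,\mathbf 0,\mathbf 1)$ such that $(B,\oplus,\mathbf 0)$ is a commutative monoid, $(B,\otimes,\mathbf 1)$ is a monoid, and $b\otimes\mathbf 0=\mathbf 0\otimes b=\mathbf 0$ for all $b$. It is right-distributive if $(a\oplus b)\otimes c=(a\otimes c)\oplus(b\otimes c)$ for all $a,b,c$, and idempotent if $b\oplus b=b$ for all $b$. It is locally finite if for each finite $A\subseteq B$, the smallest subset of $B$ containing $A\cup\{\mathbf 0,\mathbf 1\}$ and closed under $\oplus,\otimes$ is finite. The weak closure of $A\subseteq B$ is the smallest $C\subseteq B$ with $A\cup\{\mathbf 0,\mathbf 1\}\subseteq C$ and $b\oplus b'\in C$, $b\otimes a\in C$ for all $b,b'\in C$, $a\in A$. It is weakly locally finite if the weak closure of each finite $A\subseteq B$ is finite. Terms. $\mathrm{T}(X)$ is the set of all terms built from elements of $X$, constants $\hat 0,\hat 1$, and binary symbols $\hat+,\hat\times$ (infix). $\mathrm{size}(t)$ is the total number of occurrences of symbols (elements of $X$,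 constants, binary symbols) in $t$. Simple terms. $s\in \mathrm{T}(X)$ is simple if $s=\hat 0$, or $s$ contains neither $\hat 0$ nor any subterm of the form $\hat 1\hat\times s'$ or $s'\hat\times\hat 1$. $\mathrm{ST}(X)$ is the set of simple terms. For $s,t\in \mathrm{ST}(X)$, $s=_{\mathrm{AC}}t$ means that $t$ is obtained from $s$ by finitely many steps, each replacing a subterm occurrence using, in either direction, one of: $a\hat+(b\hat+c)\leftrightarrow(a\hat+b)\hat+c$, $a\hat+b\leftrightarrow b\hat+a$, $a\hat\times(b\hat\times c)\leftrightarrow(a\hat\times b)\hat\times c$. $[s]_{\mathrm{AC}}$ is the class of $s$; $\mathbb{N}_{\mathrm{sb}}[X]=\mathrm{ST}(X)/{=_{\mathrm{AC}}}$; $0=[\hat 0]_{\mathrm{AC}}$, $1=[\hat 1]_{\mathrm{AC}}$; $X/\mathrm{AC}=\{[x]_{\mathrm{AC}}\mid x\in X\}$; $\mathrm{size}([s]_{\mathrm{AC}})=\mathrm{size}(s)$ (well defined). Operations on $\mathbb{N}_{\mathrm{sb}}[X]$: $p+0=0+p=p$, and $[s]_{\mathrm{AC}}+[t]_{\mathrm{AC}}=[s\hat+t]_{\mathrm{AC}}$ for $s,t\neq\hat 0$; $p\times 0=0\times p=0$, $p\times1=1\times p=p$, and $[s]_{\mathrm{AC}}\times[t]_{\mathrm{AC}}=[s\hat\times t]_{\mathrm{AC}}$ for $s,t\notin\{\hat 0,\hat 1\}$. Polynomials. A monomial term is a term built from elements of $X$ using only $\hat\times$; a monomial is the class of a monomial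 term. The set $\mathrm{PT}(X)$ of polynomial terms is the smallest $U\subseteq \mathrm{ST}(X)$ with: (a) $\hat 0,\hat 1$ and all monomial terms are in $U$; (b) if $s,t\in U\setminus\{\hat 0\}$ then $s\hat+t\in U$; (c) if $s$ is a monomial term and $t\in U\setminus\{\hat 0,\hat 1\}$ then $s\hat\times t\in U$. Terms arising by (b) (resp. (c)) are sum (resp. product) polynomial terms. $\mathbb{N}_{\mathrm{rd}}[X]=\{[t]_{\mathrm{AC}}\mid t\in \mathrm{PT}(X)\}$ (polynomials); classes of sum (product) polynomial terms are sum (product) polynomials. Facts making the next definition meaningful: every polynomial outside $X/\mathrm{AC}\cup\{0,1\}$ is exactly one of a sum polynomial or a product polynomial; each sum polynomial is $q_1+\dots+q_n$ with $n\ge2$ and each $q_i$ a product polynomial or in $X/\mathrm{AC}\cup\{1\}$, uniquely up to permutation; each product polynomial that is not a monomial is $m\times q'$ for a unique monomial $m$ and unique sum polynomial $q'$. Multiplication $\times_{\mathrm{rd}}$ on $\mathbb{N}_{\mathrm{rd}}[X]$, by induction on $\mathrm{size}(q)$: $q\times_{\mathrm{rd}}0=0\times_{\mathrm{rd}}q=0$, $q\times_{\mathrm{rd}}1=1\times_{\mathrm{rd}}q=q$; for $q,r\notin\{0,1\}$: if $q$ is a monomial, $q\times_{\mathrm{rd}}r=q\times r$; if $q$ is a sum polynomial, written as $q=q_1+\dots+q_n$ with $n\ge2$ and each $q_i$ a product polynomial or in $X/\mathrm{AC}\cup\{1\}$, $q\times_{\mathrm{rd}}r=q_1\times_{\mathrm{rd}}r+\dots+q_n\times_{\mathrm{rd}}r$;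 if $q=m\times q'$ with $m$ a monomial and $q'$ a sum polynomial, $q\times_{\mathrm{rd}}r=m\times(q'\times_{\mathrm{rd}}r)$. Id-reduced polynomials. A sum term is a simple term $s_1\hat+s_2$ with $s_1,s_2\in \mathrm{ST}(X)\setminus\{\hat 0\}$; a product term is a simple term $s_1\hat\times s_2$ with $s_1,s_2\in \mathrm{ST}(X)\setminus\{\hat0,\hat1\}$. Each sum term is, up to omitted parentheses, uniquely $t_1\hat+\cdots\hat+t_n$ ($n\ge2$) with every $t_i$ a product term or in $X\cup\{\hat 1\}$ (its sum-product decomposition). $\mathrm{ST}_{\mathrm{id}}(X)$ is the smallest $U\subseteq \mathrm{ST}(X)$ with: (a) $\hat0,\hat1$ and all monomial terms are in $U$; (b) if $t$ is a sum term with sum-product decomposition $t_1\hat+\cdots\hat+t_n$, all $t_i\in U$, and $t_i\neq_{\mathrm{AC}}t_j$ for $i<j$, then $t\in U$; (c) if $s,t\in U\setminus\{\hat0,\hat1\}$ then $s\hat\times t\in U$. $\mathrm{PT}_{\mathrm{id}}(X)=\mathrm{PT}(X)\cap \mathrm{ST}_{\mathrm{id}}(X)$, and $\mathbb{B}_{\mathrm{id,rd}}[X]=\{[t]_{\mathrm{AC}}\mid t\in \mathrm{PT}_{\mathrm{id}}(X)\}\subseteq\mathbb{N}_{\mathrm{rd}}[X]$ is the set of id-reduced polynomials; it is closed under $\times_{\mathrm{rd}}$. Addition $+_{\mathrm{id}}$ on $\mathbb{B}_{\mathrm{id,rd}}[X]$: $q+_{\mathrm{id}}0=0+_{\mathrm{id}}q=q$.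 For $q,r\ne0$ write $q=q_1+\dots+q_k$ and $r=r_1+\dots+r_n$ ($k,n\ge1$) with the $q_i$ pairwise different, the $r_j$ pairwise different, each being $1$, a monomial, or an id-reduced product polynomial; then $q+_{\mathrm{id}}r=q_1+\dots+q_k+r_{i_1}+\dots+r_{i_\ell}$ where $\{i_1,\dots,i_\ell\}$ is the maximal subset of $\{1,\dots,n\}$ with $\{q_1,\dots,q_k\}\cap\{r_{i_1},\dots,r_{i_\ell}\}=\emptyset$. Large polynomials. For $p,q\in\mathbb{B}_{\mathrm{id,rd}}[X]$, $p$ is a subpolynomial of $q$ if $p=[s]_{\mathrm{AC}}$ and $q=[t]_{\mathrm{AC}}$ for some $s,t\in \mathrm{PT}_{\mathrm{id}}(X)$ such that $s$ is a subterm of $t$. A polynomial $q\in\mathbb{B}_{\mathrm{id,rd}}[X]\setminus\{0,1\}$ is large if it has a subpolynomial of the form $[x]_{\mathrm{AC}}\times\big(([y_1]_{\mathrm{AC}}\times p')+\dots+([y_n]_{\mathrm{AC}}\times p')\big)$ with $n\ge1$, $x,y_1\in X$, $y_i\in X\cup\{\hat1\}$ for all $i$, $y_1,\dots,y_n$ pairwise different, and $p'\in\mathbb{B}_{\mathrm{id,rd}}[X]\setminus\{0,1\}$. Define $q\sim_L r$ iff $q=r$ or both $q$ and $r$ are large; $\sim_L$ is a congruence on $\mathsf{B}_{\mathrm{id,rd}}[X]$. *)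

theory Defs
  imports "HOL-Algebra.Ring"
begin

section \<open>Strong bimonoids\<close>

text \<open>The record type \<open>ring\<close> of HOL-Algebra only supplies the signature (carrier, two operations,
  two constants); no ring axioms are assumed.\<close>

locale strong_bimonoid = abelian_monoid R + monoid R for R (structure) +
  assumes l_null: "b \<in> carrier R \<Longrightarrow> \<zero> \<otimes> b = \<zero>"
    and r_null: "b \<in> carrier R \<Longrightarrow> b \<otimes> \<zero> = \<zero>"

definition right_distributive :: "('b, 'm) ring_scheme \<Rightarrow> bool" where
  "right_distributive R \<longleftrightarrow> (\<forall>a\<in>carrier R. \<forall>b\<in>carrier R. \<forall>c\<in>carrier R.
     (a \<oplus>\<^bsub>R\<^esub> b) \<otimes>\<^bsub>R\<^esub> c = (a \<otimes>\<^bsub>R\<^esub> c) \<oplus>\<^bsub>R\<^esub> (b \<otimes>\<^bsub>R\<^esub> c))"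

definition idempotent_bimonoid :: "('b, 'm) ring_scheme \<Rightarrow> bool" where
  "idempotent_bimonoid R \<longleftrightarrow> (\<forall>b\<in>carrier R. b \<oplus>\<^bsub>R\<^esub> b = b)"

inductive_set bimonoid_closure :: "('b, 'm) ring_scheme \<Rightarrow> 'b set \<Rightarrow> 'b set"
  for R (structure) and A where
  incl: "a \<in> A \<Longrightarrow> a \<in> bimonoid_closure R A"
| zero: "\<zero> \<in> bimonoid_closure R A"
| one: "\<one> \<in> bimonoid_closure R A"
| add: "b \<in> bimonoid_closure R A \<Longrightarrow> b' \<in> bimonoid_closure R A \<Longrightarrow> b \<oplus> b' \<in> bimonoid_closure R A"
| mult: "b \<in> bimonoid_closure R A \<Longrightarrow> b' \<in> bimonoid_closure R A \<Longrightarrow> b \<otimes> b' \<in> bimonoid_closure R A"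

definition locally_finite :: "('b, 'm) ring_scheme \<Rightarrow> bool" where
  "locally_finite R \<longleftrightarrow> (\<forall>A. A \<subseteq> carrier R \<longrightarrow> finite A \<longrightarrow> finite (bimonoid_closure R A))"

inductive_set weak_closure :: "('b, 'm) ring_scheme \<Rightarrow> 'b set \<Rightarrow> 'b set"
  for R (structure) and A where
  incl: "a \<in> A \<Longrightarrow> a \<in> weak_closure R A"
| zero: "\<zero> \<in> weak_closure R A"
| one: "\<one> \<in> weak_closure R A"
| add: "b \<in> weak_closure R A \<Longrightarrow> b' \<in> weak_closure R A \<Longrightarrow> b \<oplus> b' \<in> weak_closure R A"
| mult: "b \<in> weak_closure R A \<Longrightarrow> a \<in> A \<Longrightarrow> b \<otimes> a \<in> weak_closure R A"

definition weakly_locally_finite :: "('b, 'm) ring_scheme \<Rightarrow> bool" where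
  "weakly_locally_finite R \<longleftrightarrow> (\<forall>A. A \<subseteq> carrier R \<longrightarrow> finite A \<longrightarrow> finite (weak_closure R A))"

text \<open>The union over representatives is a single class exactly when \<open>E\<close> is compatible with the
  operation; otherwise the quotient is not closed under its operations.\<close>

definition quotient_bimonoid :: "('b, 'm) ring_scheme \<Rightarrow> ('b \<times> 'b) set \<Rightarrow> 'b set ring" where
  "quotient_bimonoid R E =
     \<lparr>carrier = carrier R // E,
      mult = (\<lambda>P Q. \<Union>p\<in>P. \<Union>q\<in>Q. E `` {p \<otimes>\<^bsub>R\<^esub> q}),
      one = E `` {\<one>\<^bsub>R\<^esub>},
      zero = E `` {\<zero>\<^bsub>R\<^esub>},
      add = (\<lambda>P Q. \<Union>p\<in>P. \<Union>q\<in>Q. E `` {p \<oplus>\<^bsub>R\<^esub> q})\<rparr>"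


section \<open>Terms and simple terms\<close>

datatype (vars: 'a) trm =
    TVar 'a
  | T0 ("\<^bold>0")
  | T1 ("\<^bold>1")
  | TPlus "'a trm" "'a trm" (infixl "\<^bold>+" 65)
  | TTimes "'a trm" "'a trm" (infixl "\<^bold>\<times>" 70)

definition terms :: "'a set \<Rightarrow> 'a trm set" where
  "terms X = {t. vars t \<subseteq> X}"

primrec subterms :: "'a trm \<Rightarrow> 'a trm set" where
  "subterms (TVar x) = {TVar x}"
| "subterms \<^bold>0 = {\<^bold>0}"
| "subterms \<^bold>1 = {\<^bold>1}"
| "subterms (s \<^bold>+ t) = {s \<^bold>+ t} \<union> subterms s \<union> subterms t"
| "subterms (s \<^bold>\<times> t) = {s \<^bold>\<times> t} \<union> subterms s \<union> subterms t"

definition simple :: "'a trm \<Rightarrow> bool" where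
  "simple s \<longleftrightarrow> s = \<^bold>0 \<or>
     (\<^bold>0 \<notin> subterms s \<and> (\<forall>s'. \<^bold>1 \<^bold>\<times> s' \<notin> subterms s \<and> s' \<^bold>\<times> \<^bold>1 \<notin> subterms s))"

definition ST :: "'a set \<Rightarrow> 'a trm set" where
  "ST X = {s \<in> terms X. simple s}"

inductive ac_step :: "'a trm \<Rightarrow> 'a trm \<Rightarrow> bool" where
  plus_assoc: "ac_step (a \<^bold>+ (b \<^bold>+ c)) ((a \<^bold>+ b) \<^bold>+ c)"
| plus_comm: "ac_step (a \<^bold>+ b) (b \<^bold>+ a)"
| times_assoc: "ac_step (a \<^bold>\<times> (b \<^bold>\<times> c)) ((a \<^bold>\<times> b) \<^bold>\<times> c)"
| plus_left: "ac_step s s' \<Longrightarrow> ac_step (s \<^bold>+ t) (s' \<^bold>+ t)"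
| plus_right: "ac_step t t' \<Longrightarrow> ac_step (s \<^bold>+ t) (s \<^bold>+ t')"
| times_left: "ac_step s s' \<Longrightarrow> ac_step (s \<^bold>\<times> t) (s' \<^bold>\<times> t)"
| times_right: "ac_step t t' \<Longrightarrow> ac_step (s \<^bold>\<times> t) (s \<^bold>\<times> t')"

definition ac_eq :: "'a trm \<Rightarrow> 'a trm \<Rightarrow> bool" (infix "=\<^sub>A\<^sub>C" 50) where
  "s =\<^sub>A\<^sub>C t \<longleftrightarrow> equivclp ac_step s t"

text \<open>Steps in either direction preserve the set of variables and simplicity, so the class of a
  term in \<open>ST X\<close> consists of terms in \<open>ST X\<close> and there is no need to restrict it.\<close>

definition ac_class :: "'a trm \<Rightarrow> 'a trm set" ("[_]\<^sub>A\<^sub>C") where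
  "[s]\<^sub>A\<^sub>C = {t. s =\<^sub>A\<^sub>C t}"


section \<open>Operations on classes of simple terms\<close>

definition sb_plus :: "'a trm set \<Rightarrow> 'a trm set \<Rightarrow> 'a trm set" (infixl "+\<^sub>s\<^sub>b" 65) where
  "p +\<^sub>s\<^sub>b q =
     (if p = [\<^bold>0]\<^sub>A\<^sub>C then q else if q = [\<^bold>0]\<^sub>A\<^sub>C then p
      else \<Union>s\<in>p. \<Union>t\<in>q. [s \<^bold>+ t]\<^sub>A\<^sub>C)"

definition sb_times :: "'a trm set \<Rightarrow> 'a trm set \<Rightarrow> 'a trm set" (infixl "\<times>\<^sub>s\<^sub>b" 70) where
  "p \<times>\<^sub>s\<^sub>b q =
     (if p = [\<^bold>0]\<^sub>A\<^sub>C \<or> q = [\<^bold>0]\<^sub>A\<^sub>C then [\<^bold>0]\<^sub>A\<^sub>C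
      else if p = [\<^bold>1]\<^sub>A\<^sub>C then q else if q = [\<^bold>1]\<^sub>A\<^sub>C then p
      else \<Union>s\<in>p. \<Union>t\<in>q. [s \<^bold>\<times> t]\<^sub>A\<^sub>C)"

definition sb_sum :: "'a trm set list \<Rightarrow> 'a trm set" where
  "sb_sum ps = foldr (+\<^sub>s\<^sub>b) ps [\<^bold>0]\<^sub>A\<^sub>C"


section \<open>Polynomials and right-distributive multiplication\<close>

inductive_set monomial_terms :: "'a set \<Rightarrow> 'a trm set" for X where
  "x \<in> X \<Longrightarrow> TVar x \<in> monomial_terms X"
| "s \<in> monomial_terms X \<Longrightarrow> t \<in> monomial_terms X \<Longrightarrow> s \<^bold>\<times> t \<in> monomial_terms X"

inductive_set PT :: "'a set \<Rightarrow> 'a trm set" for X where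
  zero: "\<^bold>0 \<in> PT X"
| one: "\<^bold>1 \<in> PT X"
| monomial: "s \<in> monomial_terms X \<Longrightarrow> s \<in> PT X"
| sum: "s \<in> PT X \<Longrightarrow> s \<noteq> \<^bold>0 \<Longrightarrow> t \<in> PT X \<Longrightarrow> t \<noteq> \<^bold>0 \<Longrightarrow> s \<^bold>+ t \<in> PT X"
| product: "s \<in> monomial_terms X \<Longrightarrow> t \<in> PT X \<Longrightarrow> t \<notin> {\<^bold>0, \<^bold>1} \<Longrightarrow> s \<^bold>\<times> t \<in> PT X"

definition polynomials :: "'a set \<Rightarrow> 'a trm set set" where
  "polynomials X = {[t]\<^sub>A\<^sub>C | t. t \<in> PT X}"

definition generators :: "'a set \<Rightarrow> 'a trm set set" where
  "generators X = {[TVar x]\<^sub>A\<^sub>C | x. x \<in> X}"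

definition monomials :: "'a set \<Rightarrow> 'a trm set set" where
  "monomials X = {[s]\<^sub>A\<^sub>C | s. s \<in> monomial_terms X}"

definition sum_polynomials :: "'a set \<Rightarrow> 'a trm set set" where
  "sum_polynomials X = {[s \<^bold>+ t]\<^sub>A\<^sub>C | s t. s \<in> PT X - {\<^bold>0} \<and> t \<in> PT X - {\<^bold>0}}"

definition product_polynomials :: "'a set \<Rightarrow> 'a trm set set" where
  "product_polynomials X =
     {[s \<^bold>\<times> t]\<^sub>A\<^sub>C | s t. s \<in> monomial_terms X \<and> t \<in> PT X - {\<^bold>0, \<^bold>1}}"

text \<open>The graph of the multiplication, one rule per clause of its recursive definition; the
  decompositions of sum and product polynomials are unique (up to permutation of summands), so
  the graph is functional on polynomials.\<close>

inductive rd_graph :: "'a set \<Rightarrow> 'a trm set \<Rightarrow> 'a trm set \<Rightarrow> 'a trm set \<Rightarrow> bool" for X where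
  zero_right: "q \<in> polynomials X \<Longrightarrow> rd_graph X q [\<^bold>0]\<^sub>A\<^sub>C [\<^bold>0]\<^sub>A\<^sub>C"
| zero_left: "q \<in> polynomials X \<Longrightarrow> rd_graph X [\<^bold>0]\<^sub>A\<^sub>C q [\<^bold>0]\<^sub>A\<^sub>C"
| one_right: "q \<in> polynomials X \<Longrightarrow> rd_graph X q [\<^bold>1]\<^sub>A\<^sub>C q"
| one_left: "q \<in> polynomials X \<Longrightarrow> rd_graph X [\<^bold>1]\<^sub>A\<^sub>C q q"
| monomial: "q \<in> monomials X \<Longrightarrow> r \<in> polynomials X - {[\<^bold>0]\<^sub>A\<^sub>C, [\<^bold>1]\<^sub>A\<^sub>C} \<Longrightarrow>
    rd_graph X q r (q \<times>\<^sub>s\<^sub>b r)"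
| sum: "q \<in> sum_polynomials X \<Longrightarrow> r \<in> polynomials X - {[\<^bold>0]\<^sub>A\<^sub>C, [\<^bold>1]\<^sub>A\<^sub>C} \<Longrightarrow>
    q = sb_sum qs \<Longrightarrow> length qs \<ge> 2 \<Longrightarrow>
    set qs \<subseteq> product_polynomials X \<union> generators X \<union> {[\<^bold>1]\<^sub>A\<^sub>C} \<Longrightarrow>
    list_all2 (\<lambda>q\<^sub>i p\<^sub>i. rd_graph X q\<^sub>i r p\<^sub>i) qs ps \<Longrightarrow>
    rd_graph X q r (sb_sum ps)"
| product: "m \<in> monomials X \<Longrightarrow> q' \<in> sum_polynomials X \<Longrightarrow>
    r \<in> polynomials X - {[\<^bold>0]\<^sub>A\<^sub>C, [\<^bold>1]\<^sub>A\<^sub>C} \<Longrightarrow> q = m \<times>\<^sub>s\<^sub>b q' \<Longrightarrow>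
    rd_graph X q' r p \<Longrightarrow> rd_graph X q r (m \<times>\<^sub>s\<^sub>b p)"

definition rd_times :: "'a set \<Rightarrow> 'a trm set \<Rightarrow> 'a trm set \<Rightarrow> 'a trm set" where
  "rd_times X q r = (THE p. rd_graph X q r p)"


section \<open>Id-reduced polynomials and idempotent addition\<close>

definition sum_terms :: "'a set \<Rightarrow> 'a trm set" where
  "sum_terms X = {s \<^bold>+ t | s t. s \<in> ST X - {\<^bold>0} \<and> t \<in> ST X - {\<^bold>0}}"

text \<open>The sum-product decomposition of a sum term.\<close>

fun summands :: "'a trm \<Rightarrow> 'a trm list" where
  "summands (s \<^bold>+ t) = summands s @ summands t"
| "summands t = [t]"

inductive_set ST_id :: "'a set \<Rightarrow> 'a trm set" for X where
  zero: "\<^bold>0 \<in> ST_id X"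
| one: "\<^bold>1 \<in> ST_id X"
| monomial: "s \<in> monomial_terms X \<Longrightarrow> s \<in> ST_id X"
| sum: "t \<in> sum_terms X \<Longrightarrow> (\<forall>u \<in> set (summands t). u \<in> ST_id X) \<Longrightarrow>
    sorted_wrt (\<lambda>u v. \<not> u =\<^sub>A\<^sub>C v) (summands t) \<Longrightarrow> t \<in> ST_id X"
| product: "s \<in> ST_id X \<Longrightarrow> s \<notin> {\<^bold>0, \<^bold>1} \<Longrightarrow> t \<in> ST_id X \<Longrightarrow> t \<notin> {\<^bold>0, \<^bold>1} \<Longrightarrow>
    s \<^bold>\<times> t \<in> ST_id X"

definition PT_id :: "'a set \<Rightarrow> 'a trm set" where
  "PT_id X = PT X \<inter> ST_id X"

definition id_polynomials :: "'a set \<Rightarrow> 'a trm set set" where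
  "id_polynomials X = {[t]\<^sub>A\<^sub>C | t. t \<in> PT_id X}"

definition id_decomp :: "'a set \<Rightarrow> 'a trm set \<Rightarrow> 'a trm set list \<Rightarrow> bool" where
  "id_decomp X q qs \<longleftrightarrow> qs \<noteq> [] \<and> distinct qs \<and>
     set qs \<subseteq> {[\<^bold>1]\<^sub>A\<^sub>C} \<union> monomials X \<union> (product_polynomials X \<inter> id_polynomials X) \<and>
     q = sb_sum qs"

text \<open>The result does not depend on the decompositions, which are unique up to permutation.\<close>

definition id_plus :: "'a set \<Rightarrow> 'a trm set \<Rightarrow> 'a trm set \<Rightarrow> 'a trm set" where
  "id_plus X q r =
     (if r = [\<^bold>0]\<^sub>A\<^sub>C then q else if q = [\<^bold>0]\<^sub>A\<^sub>C then r
      else THE p. \<exists>qs rs. id_decomp X q qs \<and> id_decomp X r rs \<and>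
             p = sb_sum (qs @ filter (\<lambda>r\<^sub>j. r\<^sub>j \<notin> set qs) rs))"

definition B_id_rd :: "'a set \<Rightarrow> 'a trm set ring" where
  "B_id_rd X =
     \<lparr>carrier = id_polynomials X, mult = rd_times X, one = [\<^bold>1]\<^sub>A\<^sub>C,
      zero = [\<^bold>0]\<^sub>A\<^sub>C, add = id_plus X\<rparr>"


section \<open>Large polynomials and the quotient\<close>

definition subpolynomial :: "'a set \<Rightarrow> 'a trm set \<Rightarrow> 'a trm set \<Rightarrow> bool" where
  "subpolynomial X p q \<longleftrightarrow>
     (\<exists>s\<in>PT_id X. \<exists>t\<in>PT_id X. p = [s]\<^sub>A\<^sub>C \<and> q = [t]\<^sub>A\<^sub>C \<and> s \<in> subterms t)"

definition large :: "'a set \<Rightarrow> 'a trm set \<Rightarrow> bool" where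
  "large X q \<longleftrightarrow> q \<in> id_polynomials X - {[\<^bold>0]\<^sub>A\<^sub>C, [\<^bold>1]\<^sub>A\<^sub>C} \<and>
     (\<exists>x ys p'. x \<in> X \<and> ys \<noteq> [] \<and> hd ys \<in> TVar ` X \<and> set ys \<subseteq> TVar ` X \<union> {\<^bold>1} \<and> distinct ys \<and>
        p' \<in> id_polynomials X - {[\<^bold>0]\<^sub>A\<^sub>C, [\<^bold>1]\<^sub>A\<^sub>C} \<and>
        subpolynomial X ([TVar x]\<^sub>A\<^sub>C \<times>\<^sub>s\<^sub>b sb_sum (map (\<lambda>y. [y]\<^sub>A\<^sub>C \<times>\<^sub>s\<^sub>b p') ys)) q)"

definition large_rel :: "'a set \<Rightarrow> ('a trm set \<times> 'a trm set) set" where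
  "large_rel X = {(q, r). q \<in> id_polynomials X \<and> r \<in> id_polynomials X \<and>
     (q = r \<or> large X q \<and> large X r)}"

definition M_bimonoid :: "'a set \<Rightarrow> 'a trm set set ring" where
  "M_bimonoid X = quotient_bimonoid (B_id_rd X) (large_rel X)"

end

theory Submission
  imports Defs "HOL-Library.Multiset"
begin

text \<open>The idea is to replace terms modulo associativity and commutativity by forests. A summand of a
  polynomial is either \<open>1\<close> or of the form \<open>x \<times> q\<close> with a variable \<open>x\<close> and a polynomial \<open>q \<noteq> 0\<close>, and
  because \<open>\<times>\<close> does not distribute over the sum \<open>q\<close> from the left, \<open>x \<times> q\<close> cannot be split any
  further. So a polynomial is a finite forest with edges labelled by variables: a leaf is the
  summand \<open>1\<close>, and a branch that starts with an edge \<open>x\<close> and continues with the forest of \<open>q\<close> is the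
  summand \<open>x \<times> q\<close>. The laws for \<open>+\<close> make a forest a multiset of branches; associativity of \<open>\<times>\<close>
  disappears, since a product of variables is one path. Lemma \<open>PT_ac_eq_iff\<close> says that this
  picture is exact.

  All notions of the theorem become simple in it. The product \<open>q \<times>\<^bsub>rd\<^esub> r\<close> puts a copy of \<open>r\<close> in
  place of every leaf of \<open>q\<close> (\<open>rd_times_poly_class\<close>). A polynomial is id-reduced when no
  two sibling branches are equal, and then \<open>+\<^bsub>id\<^esub>\<close> is union (\<open>id_plus_poly_class\<close>).
  A polynomial is large when some edge of its forest is followed by a product \<open>A \<odot> P\<close>, where
  \<open>A\<close> is a sum of distinct variables and possibly \<open>1\<close>, with at least one variable, and \<open>P\<close> is neither
  \<open>0\<close> nor \<open>1\<close> (\<open>large_poly_class\<close>). Such a pattern survives in every sum, in every product with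
  nonzero factors on the left (which carry the whole large forest at their leaves) and in every
  product with nonzero factors on the right (which turn \<open>A \<odot> P\<close> into \<open>A \<odot> (P \<odot> R)\<close>). This is
  why \<open>\<sim>\<^sub>L\<close> is a congruence; the algebraic laws of the quotient are then inherited from
  union and substitution of forests.

  Weak local finiteness rests on one observation (\<open>large_triple_product\<close>): a product
  \<open>P \<odot> (Q \<odot> R)\<close> of three polynomials different from \<open>0\<close> and \<open>1\<close> is always large. If \<open>Q\<close> is itself
  a sum of variables and possibly \<open>1\<close>, then \<open>P\<close> has an edge that ends in a single leaf, and in the
  product this edge is followed by \<open>Q \<odot> R\<close>. Otherwise \<open>Q\<close> contains an edge followed by such a
  sum \<open>A\<close>, and in \<open>Q \<odot> R\<close> that edge is followed by \<open>A \<odot> R\<close>. Hence the products of elements of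
  a finite set \<open>F\<close> form a finite set modulo \<open>\<sim>\<^sub>L\<close>; by right-distributivity the weak closure of
  \<open>F\<close> consists of sums of these products, and by idempotency there are only finitely many sums.

  Local finiteness fails because a full closure may also multiply from the left: starting with \<open>x\<close>
  it contains \<open>1\<close>, \<open>1 + x\<close>, \<open>1 + x \<times> (1 + x)\<close>, \<open>1 + x \<times> (1 + x \<times> (1 + x))\<close>, \<dots>, which are pairwise
  different, and none of these is large (\<open>comb_not_large\<close>).\<close>

section \<open>Terms modulo associativity and commutativity\<close>

lemma ac_eq_refl [simp, intro]: "s =\<^sub>A\<^sub>C s"
  by (simp add: ac_eq_def)

lemma ac_eq_sym: "s =\<^sub>A\<^sub>C t \<Longrightarrow> t =\<^sub>A\<^sub>C s"
  by (simp add: ac_eq_def equivclp_sym)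

lemma ac_eq_trans [trans]: "s =\<^sub>A\<^sub>C t \<Longrightarrow> t =\<^sub>A\<^sub>C u \<Longrightarrow> s =\<^sub>A\<^sub>C u"
  unfolding ac_eq_def by (rule equivclp_trans)

lemma ac_step_imp_ac_eq: "ac_step s t \<Longrightarrow> s =\<^sub>A\<^sub>C t"
  by (simp add: ac_eq_def r_into_equivclp)

lemma ac_eq_context:
  assumes "s =\<^sub>A\<^sub>C t" and "\<And>u v. ac_step u v \<Longrightarrow> ac_step (C u) (C v)"
  shows "C s =\<^sub>A\<^sub>C C t"
  using assms(1) unfolding ac_eq_def
proof (induction rule: equivclp_induct)
  case (step u v)
  then have "C u =\<^sub>A\<^sub>C C v"
    by (auto intro: ac_step_imp_ac_eq ac_eq_sym assms(2))
  with step.IH show ?case by (metis ac_eq_def ac_eq_trans)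
qed simp

text \<open>To find an invariant of AC classes it is enough to look at single oriented steps; this is applied
  to membership in \<open>PT\<close> and to the forest of a term.\<close>

lemma ac_eq_invariant:
  assumes "s =\<^sub>A\<^sub>C t" and "\<And>u v. ac_step u v \<Longrightarrow> f u = f v"
  shows "f s = f t"
  using assms(1) unfolding ac_eq_def
proof (induction rule: equivclp_induct)
  case (step u v)
  then have "f u = f v" by (metis assms(2))
  with step.IH show ?case by simp
qed simp

lemma ac_eq_plus_cong:
  assumes "s =\<^sub>A\<^sub>C s'" "t =\<^sub>A\<^sub>C t'" shows "s \<^bold>+ t =\<^sub>A\<^sub>C s' \<^bold>+ t'"
proof -
  have "s \<^bold>+ t =\<^sub>A\<^sub>C s' \<^bold>+ t"
    by (rule ac_eq_context[OF assms(1)]) (rule plus_left)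
  also have "\<dots> =\<^sub>A\<^sub>C s' \<^bold>+ t'"
    by (rule ac_eq_context[OF assms(2)]) (rule plus_right)
  finally show ?thesis .
qed

lemma ac_eq_times_cong:
  assumes "s =\<^sub>A\<^sub>C s'" "t =\<^sub>A\<^sub>C t'" shows "s \<^bold>\<times> t =\<^sub>A\<^sub>C s' \<^bold>\<times> t'"
proof -
  have "s \<^bold>\<times> t =\<^sub>A\<^sub>C s' \<^bold>\<times> t"
    by (rule ac_eq_context[OF assms(1)]) (rule times_left)
  also have "\<dots> =\<^sub>A\<^sub>C s' \<^bold>\<times> t'"
    by (rule ac_eq_context[OF assms(2)]) (rule times_right)
  finally show ?thesis .
qed

lemma ac_eq_plus_assoc: "(a \<^bold>+ b) \<^bold>+ c =\<^sub>A\<^sub>C a \<^bold>+ (b \<^bold>+ c)"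
  by (rule ac_eq_sym) (rule ac_step_imp_ac_eq, rule plus_assoc)

lemma ac_eq_plus_comm: "a \<^bold>+ b =\<^sub>A\<^sub>C b \<^bold>+ a"
  by (rule ac_step_imp_ac_eq, rule plus_comm)

lemma ac_eq_times_assoc: "(a \<^bold>\<times> b) \<^bold>\<times> c =\<^sub>A\<^sub>C a \<^bold>\<times> (b \<^bold>\<times> c)"
  by (rule ac_eq_sym) (rule ac_step_imp_ac_eq, rule times_assoc)

lemma ac_class_eq_iff: "[s]\<^sub>A\<^sub>C = [t]\<^sub>A\<^sub>C \<longleftrightarrow> s =\<^sub>A\<^sub>C t"
  unfolding ac_class_def by (blast intro: ac_eq_trans ac_eq_sym)

inductive_simps monomial_terms_simps [simp]:
  "TVar x \<in> monomial_terms X" "\<^bold>0 \<in> monomial_terms X" "\<^bold>1 \<in> monomial_terms X"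
  "s \<^bold>+ t \<in> monomial_terms X" "s \<^bold>\<times> t \<in> monomial_terms X"

inductive_simps PT_inversions:
  "TVar x \<in> PT X" "s \<^bold>+ t \<in> PT X" "s \<^bold>\<times> t \<in> PT X"

lemma PT_simps [simp]:
  "\<^bold>0 \<in> PT X" "\<^bold>1 \<in> PT X" "TVar x \<in> PT X \<longleftrightarrow> x \<in> X"
  "s \<^bold>+ t \<in> PT X \<longleftrightarrow> s \<in> PT X \<and> s \<noteq> \<^bold>0 \<and> t \<in> PT X \<and> t \<noteq> \<^bold>0"
  "s \<^bold>\<times> t \<in> PT X \<longleftrightarrow> s \<in> monomial_terms X \<and> t \<in> PT X \<and> t \<noteq> \<^bold>0 \<and> t \<noteq> \<^bold>1"
  by (auto simp: PT_inversions PT.zero PT.one intro: PT.monomial)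

lemma ac_step_atomic: "ac_step u v \<Longrightarrow> u \<noteq> \<^bold>0 \<and> v \<noteq> \<^bold>0 \<and> u \<noteq> \<^bold>1 \<and> v \<noteq> \<^bold>1"
  by (induction rule: ac_step.induct) auto

lemma ac_step_monomial_terms: "ac_step u v \<Longrightarrow> u \<in> monomial_terms X \<longleftrightarrow> v \<in> monomial_terms X"
  by (induction rule: ac_step.induct) auto

text \<open>A monomial factor on the left may be split or merged by reassociation, but what stays on its right
  is in \<open>PT X\<close> and different from the constants, which no step touches.\<close>

lemma ac_step_PT: "ac_step u v \<Longrightarrow> u \<in> PT X \<longleftrightarrow> v \<in> PT X"
  by (induction rule: ac_step.induct) (auto dest: ac_step_atomic simp: ac_step_monomial_terms)

lemma ac_eq_PT: "s =\<^sub>A\<^sub>C t \<Longrightarrow> s \<in> PT X \<longleftrightarrow> t \<in> PT X"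
  by (erule ac_eq_invariant) (rule ac_step_PT)

section \<open>Forests\<close>

datatype 'a branch = Leaf | Edge 'a "'a branch multiset"

type_synonym 'a forest = "'a branch multiset"

text \<open>Grafting onto an edge is multiplication by a variable from the left. The empty forest is treated
  separately because \<open>x \<times> 0 = 0\<close>; this makes \<open>\<odot>\<close> satisfy the zero laws and keeps edges that end in
  nothing out of all forests that come from terms.\<close>

definition graft :: "'a \<Rightarrow> 'a forest \<Rightarrow> 'a forest" where
  "graft x P = (if P = {#} then {#} else {#Edge x P#})"

text \<open>Substitution of \<open>R\<close> for every leaf.\<close>

primrec branch_times :: "'a forest \<Rightarrow> 'a branch \<Rightarrow> 'a forest" where
  "branch_times R Leaf = R"
| "branch_times R (Edge x P) = graft x (\<Sum>\<^sub># (image_mset (branch_times R) P))"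

definition forest_times :: "'a forest \<Rightarrow> 'a forest \<Rightarrow> 'a forest" (infixl "\<odot>" 70) where
  "P \<odot> R = \<Sum>\<^sub># (image_mset (branch_times R) P)"

abbreviation unit :: "'a forest" where "unit \<equiv> {#Leaf#}"

lemma graft_eq_empty [simp]: "graft x P = {#} \<longleftrightarrow> P = {#}"
  by (simp add: graft_def)

lemma times_empty_left [simp]: "{#} \<odot> R = {#}"
  by (simp add: forest_times_def)

lemma times_plus_left: "(P + Q) \<odot> R = P \<odot> R + Q \<odot> R"
  by (simp add: forest_times_def)

lemma times_add_mset: "add_mset b P \<odot> R = {#b#} \<odot> R + P \<odot> R"
  by (simp add: forest_times_def)

lemma times_Leaf [simp]: "unit \<odot> R = R"
  by (simp add: forest_times_def)

lemma times_Edge: "{#Edge x P#} \<odot> R = graft x (P \<odot> R)"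
  by (simp add: forest_times_def)

lemma graft_times: "graft x P \<odot> R = graft x (P \<odot> R)"
  by (auto simp: times_Edge graft_def[of x P])

text \<open>Structural induction with the shape of a term: identities that respect \<open>+\<close> and grafting need no
  nested induction over branches and multisets.\<close>

lemma forest_induct [case_names empty Leaf Edge plus]:
  assumes "Q {#}" "Q unit" "\<And>x P. Q P \<Longrightarrow> Q {#Edge x P#}" "\<And>P R. Q P \<Longrightarrow> Q R \<Longrightarrow> Q (P + R)"
  shows "Q P"
proof -
  have *: "(\<forall>b\<in>#P. Q {#b#}) \<Longrightarrow> Q P" for P
  proof (induction P)
    case (add b P)
    then have "Q ({#b#} + P)" by (intro assms(4)) auto
    then show ?case by simp
  qed (rule assms)
  have "Q {#b#}" for b
  proof (induction b)
    case (Edge x P)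
    then have "Q P" using *[of P] by blast
    then show ?case by (rule assms(3))
  qed (rule assms)
  then show ?thesis using *[of P] by blast
qed

lemma times_empty_right [simp]: "P \<odot> {#} = {#}"
  by (induction P rule: forest_induct) (auto simp: times_plus_left times_Edge)

lemma forest_times_assoc: "(P \<odot> Q) \<odot> R = P \<odot> (Q \<odot> R)"
  by (induction P rule: forest_induct) (auto simp: times_plus_left times_Edge graft_times)

text \<open>These are the forests of polynomials over \<open>X\<close>: labels in \<open>X\<close>, and no edge without continuation.\<close>

inductive_set forests :: "'a set \<Rightarrow> 'a forest set" for X where
  empty: "{#} \<in> forests X"
| Leaf: "unit \<in> forests X"
| Edge: "x \<in> X \<Longrightarrow> P \<in> forests X \<Longrightarrow> P \<noteq> {#} \<Longrightarrow> {#Edge x P#} \<in> forests X"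
| plus: "P \<in> forests X \<Longrightarrow> Q \<in> forests X \<Longrightarrow> P + Q \<in> forests X"

lemma forests_iff: "P \<in> forests X \<longleftrightarrow> (\<forall>b\<in>#P. {#b#} \<in> forests X)"
proof
  show "P \<in> forests X \<Longrightarrow> \<forall>b\<in>#P. {#b#} \<in> forests X"
    by (induction rule: forests.induct) (auto intro: forests.intros)
next
  show "\<forall>b\<in>#P. {#b#} \<in> forests X \<Longrightarrow> P \<in> forests X"
  proof (induction P)
    case (add b P)
    then have "{#b#} + P \<in> forests X" by (intro forests.plus) auto
    then show ?case by simp
  qed (simp add: forests.empty)
qed

lemma forests_plus [simp]: "P + Q \<in> forests X \<longleftrightarrow> P \<in> forests X \<and> Q \<in> forests X"
  unfolding forests_iff[of "P + Q"] forests_iff[of P] forests_iff[of Q] by auto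

lemma forests_Edge [simp]: "{#Edge x P#} \<in> forests X \<longleftrightarrow> x \<in> X \<and> P \<in> forests X \<and> P \<noteq> {#}"
proof
  have *: "Q \<in> forests X \<Longrightarrow> \<forall>x P. Edge x P \<in># Q \<longrightarrow> x \<in> X \<and> P \<in> forests X \<and> P \<noteq> {#}" for Q
    by (induction rule: forests.induct) auto
  show "{#Edge x P#} \<in> forests X \<Longrightarrow> x \<in> X \<and> P \<in> forests X \<and> P \<noteq> {#}"
    using *[of "{#Edge x P#}"] by simp
qed (auto intro: forests.Edge)

lemma times_unit_right: "P \<in> forests X \<Longrightarrow> P \<odot> unit = P"
  by (induction rule: forests.induct) (auto simp: times_plus_left times_Edge graft_def)

text \<open>The AC laws hold under this interpretation because \<open>+\<close> on multisets is commutative and \<open>\<odot>\<close> is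
  associative.\<close>

primrec forest_of :: "'a trm \<Rightarrow> 'a forest" where
  "forest_of (TVar x) = {#Edge x unit#}"
| "forest_of \<^bold>0 = {#}"
| "forest_of \<^bold>1 = unit"
| "forest_of (s \<^bold>+ t) = forest_of s + forest_of t"
| "forest_of (s \<^bold>\<times> t) = forest_of s \<odot> forest_of t"

lemma ac_step_forest_of: "ac_step s t \<Longrightarrow> forest_of s = forest_of t"
  by (induction rule: ac_step.induct) (auto simp: forest_times_assoc)

lemma ac_eq_forest_of: "s =\<^sub>A\<^sub>C t \<Longrightarrow> forest_of s = forest_of t"
  by (erule ac_eq_invariant) (rule ac_step_forest_of)

section \<open>Polynomials are classified by their forests\<close>

text \<open>There are no zero divisors, since every branch of a forest of this kind ends in a leaf, at which
  a nonempty \<open>R\<close> can be placed.\<close>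

lemma times_eq_empty: "P \<in> forests X \<Longrightarrow> P \<odot> R = {#} \<longleftrightarrow> P = {#} \<or> R = {#}"
  by (induction rule: forests.induct) (auto simp: times_plus_left times_Edge)

lemma forests_times: "P \<in> forests X \<Longrightarrow> R \<in> forests X \<Longrightarrow> P \<odot> R \<in> forests X"
proof (induction rule: forests.induct)
  case (Edge x P)
  then show ?case by (auto simp: times_Edge graft_def forests.empty)
qed (auto simp: times_plus_left forests.empty)

inductive_set monomial_forests :: "'a set \<Rightarrow> 'a forest set" for X where
  var: "x \<in> X \<Longrightarrow> {#Edge x unit#} \<in> monomial_forests X"
| Edge: "x \<in> X \<Longrightarrow> m \<in> monomial_forests X \<Longrightarrow> {#Edge x m#} \<in> monomial_forests X"

lemma monomial_forests_props:
  "m \<in> monomial_forests X \<Longrightarrow> m \<in> forests X \<and> m \<noteq> {#} \<and> m \<noteq> unit"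
  by (induction rule: monomial_forests.induct) (auto simp: forests.Leaf)

lemma monomial_forests_times:
  "m \<in> monomial_forests X \<Longrightarrow> n \<in> monomial_forests X \<Longrightarrow> m \<odot> n \<in> monomial_forests X"
proof (induction rule: monomial_forests.induct)
  case (var x)
  then show ?case
    using monomial_forests_props[of n X] by (simp add: times_Edge graft_def monomial_forests.Edge)
next
  case (Edge x m)
  then show ?case
    using monomial_forests_props[of "m \<odot> n" X] by (simp add: times_Edge graft_def monomial_forests.Edge)
qed

lemma forest_of_monomial_terms: "forest_of ` monomial_terms X = monomial_forests X"
proof
  have "s \<in> monomial_terms X \<Longrightarrow> forest_of s \<in> monomial_forests X" for s
    by (induction rule: monomial_terms.induct) (auto intro: monomial_forests.var monomial_forests_times)
  then show "forest_of ` monomial_terms X \<subseteq> monomial_forests X" by blast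
  have "m \<in> monomial_forests X \<Longrightarrow> \<exists>s\<in>monomial_terms X. forest_of s = m" for m
  proof (induction rule: monomial_forests.induct)
    case (var x)
    then show ?case by (intro bexI[of _ "TVar x"]) auto
  next
    case (Edge x m)
    then obtain s where "s \<in> monomial_terms X" "forest_of s = m" by blast
    with Edge show ?case
      using monomial_forests_props[of m X]
      by (intro bexI[of _ "TVar x \<^bold>\<times> s"]) (auto simp: times_Edge graft_def)
  qed
  then show "monomial_forests X \<subseteq> forest_of ` monomial_terms X" by blast
qed

text \<open>A monomial is a single path, so multiplying by it from the left yields a single branch.\<close>

lemma monomial_times_Edge:
  "m \<in> monomial_terms X \<Longrightarrow> R \<noteq> {#} \<Longrightarrow> \<exists>x\<in>X. \<exists>Q. forest_of m \<odot> R = {#Edge x Q#} \<and> Q \<noteq> {#}"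
proof (induction m arbitrary: R rule: monomial_terms.induct)
  case (1 x)
  then show ?case by (auto simp: times_Edge graft_def)
next
  case (2 s t)
  from "2.IH"(2)[OF "2.prems"] have "forest_of t \<odot> R \<noteq> {#}" by auto
  from "2.IH"(1)[OF this] show ?case by (simp add: forest_times_assoc)
qed

lemma monomial_terms_PT: "s \<in> monomial_terms X \<Longrightarrow> s \<in> PT X \<and> s \<noteq> \<^bold>0 \<and> s \<noteq> \<^bold>1"
  by (auto intro: PT.monomial)

lemma forest_of_forests: "t \<in> PT X \<Longrightarrow> forest_of t \<in> forests X"
proof -
  have mono: "s \<in> monomial_terms X \<Longrightarrow> forest_of s \<in> forests X" for s
    by (induction rule: monomial_terms.induct) (auto simp: forests.Leaf intro: forests_times)
  show "t \<in> PT X \<Longrightarrow> forest_of t \<in> forests X"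
    by (induction rule: PT.induct) (auto simp: forests.empty forests.Leaf mono intro: forests_times)
qed

lemma forest_of_PT_eq_empty: "t \<in> PT X \<Longrightarrow> forest_of t = {#} \<longleftrightarrow> t = \<^bold>0"
proof (induction t)
  case (TTimes s t)
  then show ?case using monomial_times_Edge[of s X "forest_of t"] by auto
qed auto

lemma forest_of_PT_eq_unit: "t \<in> PT X \<Longrightarrow> forest_of t = unit \<longleftrightarrow> t = \<^bold>1"
proof (induction t)
  case (TPlus s t)
  then have "forest_of s \<noteq> {#}" "forest_of t \<noteq> {#}" by (auto simp: forest_of_PT_eq_empty)
  then show ?case by (auto simp: union_is_single)
next
  case (TTimes s t)
  then show ?case using monomial_times_Edge[of s X "forest_of t"] forest_of_PT_eq_empty[of t X] by auto
qed auto

text \<open>No trailing \<open>0\<close> is added, because \<open>0\<close> must not occur in a simple term other than \<open>0\<close>.\<close>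

fun sum_trm :: "'a trm list \<Rightarrow> 'a trm" where
  "sum_trm [] = \<^bold>0"
| "sum_trm [t] = t"
| "sum_trm (t # u # ts) = t \<^bold>+ sum_trm (u # ts)"

lemma sum_trm_Cons: "ts \<noteq> [] \<Longrightarrow> sum_trm (t # ts) = t \<^bold>+ sum_trm ts"
  by (cases ts) auto

lemma sum_trm_append:
  "ts \<noteq> [] \<Longrightarrow> us \<noteq> [] \<Longrightarrow> sum_trm (ts @ us) =\<^sub>A\<^sub>C sum_trm ts \<^bold>+ sum_trm us"
proof (induction ts)
  case (Cons t ts)
  show ?case
  proof (cases "ts = []")
    case False
    then have "sum_trm ((t # ts) @ us) = t \<^bold>+ sum_trm (ts @ us)" by (simp add: sum_trm_Cons)
    also have "\<dots> =\<^sub>A\<^sub>C t \<^bold>+ (sum_trm ts \<^bold>+ sum_trm us)"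
      using Cons False by (intro ac_eq_plus_cong) auto
    also have "\<dots> =\<^sub>A\<^sub>C sum_trm (t # ts) \<^bold>+ sum_trm us"
      using False by (simp add: sum_trm_Cons ac_eq_sym[OF ac_eq_plus_assoc])
    finally show ?thesis .
  qed (simp add: sum_trm_Cons Cons)
qed simp

lemma sum_trm_move: "sum_trm (ts @ t # us) =\<^sub>A\<^sub>C sum_trm (t # ts @ us)"
proof (induction ts)
  case (Cons s ts)
  have "sum_trm ((s # ts) @ t # us) = s \<^bold>+ sum_trm (ts @ t # us)"
    by (simp add: sum_trm_Cons)
  also have "\<dots> =\<^sub>A\<^sub>C s \<^bold>+ sum_trm (t # ts @ us)"
    using Cons by (intro ac_eq_plus_cong) auto
  also have "\<dots> =\<^sub>A\<^sub>C sum_trm (t # (s # ts) @ us)"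
  proof (cases "ts @ us = []")
    case True
    then show ?thesis by (simp add: ac_eq_plus_comm)
  next
    case False
    have "s \<^bold>+ (t \<^bold>+ sum_trm (ts @ us)) =\<^sub>A\<^sub>C (s \<^bold>+ t) \<^bold>+ sum_trm (ts @ us)"
      by (rule ac_eq_sym[OF ac_eq_plus_assoc])
    also have "\<dots> =\<^sub>A\<^sub>C (t \<^bold>+ s) \<^bold>+ sum_trm (ts @ us)"
      by (intro ac_eq_plus_cong ac_eq_plus_comm ac_eq_refl)
    also have "\<dots> =\<^sub>A\<^sub>C t \<^bold>+ (s \<^bold>+ sum_trm (ts @ us))"
      by (rule ac_eq_plus_assoc)
    finally show ?thesis using False by (simp add: sum_trm_Cons del: append_is_Nil_conv)
  qed
  finally show ?case .
qed simp

text \<open>Up to AC the sum of a list depends on the multiset of its entries only, so the arbitrary choice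
  of an order in the normal form below does no harm.\<close>

lemma sum_trm_perm: "mset ts = mset us \<Longrightarrow> sum_trm ts =\<^sub>A\<^sub>C sum_trm us"
proof (induction ts arbitrary: us)
  case (Cons t ts)
  then have "t \<in> set us" by (metis list.set_intros(1) set_mset_mset)
  then obtain vs ws where us: "us = vs @ t # ws" by (meson split_list)
  with Cons.prems have *: "mset ts = mset (vs @ ws)" by simp
  have "sum_trm (t # ts) =\<^sub>A\<^sub>C sum_trm (t # vs @ ws)"
  proof (cases "ts = []")
    case False
    with * have "vs @ ws \<noteq> []" by (metis mset_zero_iff)
    with False show ?thesis
      using Cons.IH[OF *] by (simp add: sum_trm_Cons ac_eq_plus_cong del: append_is_Nil_conv)
  qed (use * in simp)
  also have "\<dots> =\<^sub>A\<^sub>C sum_trm us"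
    unfolding us by (rule ac_eq_sym[OF sum_trm_move])
  finally show ?case .
qed simp

text \<open>A representative of each branch. The case distinction avoids the forbidden subterm
  \<open>x \<times> 1\<close>. The order of the summands is chosen by Hilbert's operator, since branches carry no order.
  The inner sum is \<open>nf P\<close>, which is only defined afterwards; see \<open>nf_branch_Edge\<close>.\<close>

primrec nf_branch :: "'a branch \<Rightarrow> 'a trm" where
  "nf_branch Leaf = \<^bold>1"
| "nf_branch (Edge x P) =
     (if P = unit then TVar x
      else TVar x \<^bold>\<times> sum_trm (SOME ts. mset ts = image_mset nf_branch P))"

definition nf :: "'a forest \<Rightarrow> 'a trm" where
  "nf P = sum_trm (SOME ts. mset ts = image_mset nf_branch P)"

lemma nf_obtain:
  obtains ts where "mset ts = image_mset nf_branch P" "nf P = sum_trm ts"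
  using someI_ex[OF ex_mset[of "image_mset nf_branch P"]] by (auto simp: nf_def)

lemma nf_empty [simp]: "nf {#} = \<^bold>0"
  by (rule nf_obtain[of "{#}"]) simp

lemma nf_single [simp]: "nf {#b#} = nf_branch b"
  by (rule nf_obtain[of "{#b#}"]) simp

lemma nf_branch_Edge: "nf_branch (Edge x P) = (if P = unit then TVar x else TVar x \<^bold>\<times> nf P)"
  by (simp add: nf_def)

declare nf_branch.simps(2) [simp del]

lemma nf_plus: 
  assumes "P \<noteq> {#}" "Q \<noteq> {#}"
  shows "nf (P + Q) =\<^sub>A\<^sub>C nf P \<^bold>+ nf Q"
proof -
  obtain ts where ts: "mset ts = image_mset nf_branch P" "nf P = sum_trm ts" by (rule nf_obtain)
  obtain us where us: "mset us = image_mset nf_branch Q" "nf Q = sum_trm us" by (rule nf_obtain)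
  obtain vs where vs: "mset vs = image_mset nf_branch (P + Q)" "nf (P + Q) = sum_trm vs"
    by (rule nf_obtain)
  have "nf (P + Q) =\<^sub>A\<^sub>C sum_trm (ts @ us)"
    unfolding vs(2) by (rule sum_trm_perm) (simp add: ts us vs)
  also have "\<dots> =\<^sub>A\<^sub>C nf P \<^bold>+ nf Q"
    using assms ts us by (metis image_mset_is_empty_iff mset.simps(1) sum_trm_append)
  finally show ?thesis .
qed

text \<open>The sum case goes through AC invariance, as the normal form of \<open>P + Q\<close> may interleave
  the summands of \<open>P\<close> and \<open>Q\<close>.\<close>

lemma nf_correct: "P \<in> forests X \<Longrightarrow> nf P \<in> PT X \<and> forest_of (nf P) = P"
proof (induction rule: forests.induct)
  case (Edge x P)
  then have "nf P \<noteq> \<^bold>0" by auto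
  moreover have "P \<noteq> unit \<Longrightarrow> nf P \<noteq> \<^bold>1" using Edge by auto
  ultimately show ?case using Edge by (auto simp: nf_branch_Edge times_Edge graft_def)
next
  case (plus P Q)
  show ?case
  proof (cases "P = {#} \<or> Q = {#}")
    case False
    then have *: "nf (P + Q) =\<^sub>A\<^sub>C nf P \<^bold>+ nf Q" by (intro nf_plus) auto
    from plus False have "nf P \<^bold>+ nf Q \<in> PT X" by auto
    with * plus show ?thesis using ac_eq_PT[OF *] ac_eq_forest_of[OF *] by simp
  qed (use plus in auto)
qed auto

lemma nf_PT: "P \<in> forests X \<Longrightarrow> nf P \<in> PT X"
  and forest_of_nf: "P \<in> forests X \<Longrightarrow> forest_of (nf P) = P"
  using nf_correct by blast+

lemma nf_monomial_times:
  assumes "m \<in> monomial_terms X" "R \<noteq> {#}" "R \<noteq> unit"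
  shows "m \<^bold>\<times> nf R =\<^sub>A\<^sub>C nf (forest_of m \<odot> R)"
  using assms
proof (induction m arbitrary: R rule: monomial_terms.induct)
  case (1 x)
  then show ?case by (simp add: times_Edge graft_def nf_branch_Edge)
next
  case (2 s t)
  from 2 obtain x Q where "forest_of t \<odot> R = {#Edge x Q#}" using monomial_times_Edge by blast
  then have *: "forest_of t \<odot> R \<noteq> {#}" "forest_of t \<odot> R \<noteq> unit" by auto
  have "(s \<^bold>\<times> t) \<^bold>\<times> nf R =\<^sub>A\<^sub>C s \<^bold>\<times> (t \<^bold>\<times> nf R)" by (rule ac_eq_times_assoc)
  also have "\<dots> =\<^sub>A\<^sub>C s \<^bold>\<times> nf (forest_of t \<odot> R)"
    using 2 by (intro ac_eq_times_cong) auto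
  also have "\<dots> =\<^sub>A\<^sub>C nf (forest_of s \<odot> (forest_of t \<odot> R))"
    using 2 * by auto
  finally show ?case by (simp add: forest_times_assoc)
qed

text \<open>Every polynomial term can be brought into the normal form of its forest: sums are merged by
  \<open>nf_plus\<close>, and the monomial factor of a product is moved edge by edge into its second
  factor by \<open>nf_monomial_times\<close>.\<close>

lemma PT_nf: "t \<in> PT X \<Longrightarrow> t =\<^sub>A\<^sub>C nf (forest_of t)"
proof (induction t)
  case (TVar x)
  then show ?case by (simp add: nf_branch_Edge)
next
  case (TPlus s t)
  then have "s \<^bold>+ t =\<^sub>A\<^sub>C nf (forest_of s) \<^bold>+ nf (forest_of t)"
    by (intro ac_eq_plus_cong) auto
  also have "\<dots> =\<^sub>A\<^sub>C nf (forest_of s + forest_of t)"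
    using TPlus by (intro ac_eq_sym[OF nf_plus]) (auto simp: forest_of_PT_eq_empty)
  finally show ?case by simp
next
  case (TTimes s t)
  then have "s \<^bold>\<times> t =\<^sub>A\<^sub>C s \<^bold>\<times> nf (forest_of t)"
    by (intro ac_eq_times_cong) auto
  also have "\<dots> =\<^sub>A\<^sub>C nf (forest_of s \<odot> forest_of t)"
    using TTimes by (intro nf_monomial_times[of _ X]) (auto simp: forest_of_PT_eq_empty forest_of_PT_eq_unit)
  finally show ?case by simp
qed auto

text \<open>Two polynomial terms with the same forest have the same normal form.\<close>

lemma PT_ac_eq_iff: "s \<in> PT X \<Longrightarrow> t \<in> PT X \<Longrightarrow> s =\<^sub>A\<^sub>C t \<longleftrightarrow> forest_of s = forest_of t"
  by (metis PT_nf ac_eq_forest_of ac_eq_sym ac_eq_trans)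

text \<open>The AC class that belongs to a forest; by \<open>ac_class_PT\<close> it is the class of any of its terms.\<close>

definition poly_class :: "'a set \<Rightarrow> 'a forest \<Rightarrow> 'a trm set" where
  "poly_class X P = {t \<in> PT X. forest_of t = P}"

lemma ac_class_PT:
  assumes "t \<in> PT X"
  shows "[t]\<^sub>A\<^sub>C = poly_class X (forest_of t)"
proof -
  have "t =\<^sub>A\<^sub>C u \<longleftrightarrow> u \<in> PT X \<and> forest_of u = forest_of t" for u
    using assms PT_ac_eq_iff[of t X u] ac_eq_PT[of t u X] by auto
  then show ?thesis by (simp add: ac_class_def poly_class_def)
qed

lemma poly_class_nf: "P \<in> forests X \<Longrightarrow> poly_class X P = [nf P]\<^sub>A\<^sub>C"
  by (metis ac_class_PT forest_of_nf nf_PT)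

lemma ac_class_const: "[\<^bold>0]\<^sub>A\<^sub>C = poly_class X {#}" "[\<^bold>1]\<^sub>A\<^sub>C = poly_class X unit"
  by (simp_all add: ac_class_PT[of _ X])

lemma poly_class_inject:
  "P \<in> forests X \<Longrightarrow> Q \<in> forests X \<Longrightarrow> poly_class X P = poly_class X Q \<longleftrightarrow> P = Q"
  by (metis ac_class_eq_iff ac_eq_forest_of forest_of_nf poly_class_nf)

text \<open>The operations on classes are unions over all representatives. For a compatible operation the
  union has only one member.\<close>

lemma Union_ac_class:
  assumes "\<And>s' t'. s =\<^sub>A\<^sub>C s' \<Longrightarrow> t =\<^sub>A\<^sub>C t' \<Longrightarrow> f s t =\<^sub>A\<^sub>C f s' t'"
  shows "(\<Union>s'\<in>[s]\<^sub>A\<^sub>C. \<Union>t'\<in>[t]\<^sub>A\<^sub>C. [f s' t']\<^sub>A\<^sub>C) = [f s t]\<^sub>A\<^sub>C"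
proof -
  have "[f s' t']\<^sub>A\<^sub>C = [f s t]\<^sub>A\<^sub>C" if "s' \<in> [s]\<^sub>A\<^sub>C" "t' \<in> [t]\<^sub>A\<^sub>C" for s' t'
    unfolding ac_class_eq_iff using that by (intro ac_eq_sym[OF assms]) (simp_all add: ac_class_def)
  moreover have "s \<in> [s]\<^sub>A\<^sub>C" "t \<in> [t]\<^sub>A\<^sub>C" by (auto simp: ac_class_def)
  ultimately show ?thesis by blast
qed

lemma sb_plus_poly_class:
  assumes "P \<in> forests X" "Q \<in> forests X"
  shows "poly_class X P +\<^sub>s\<^sub>b poly_class X Q = poly_class X (P + Q)"
proof (cases "P = {#} \<or> Q = {#}")
  case True
  then show ?thesis using assms
    by (auto simp: sb_plus_def poly_class_inject forests.empty ac_class_const(1)[of X])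
next
  case False
  have *: "nf P \<^bold>+ nf Q \<in> PT X"
    using assms False by (auto simp: nf_PT) (metis forest_of.simps(2) forest_of_nf)+
  have "poly_class X P +\<^sub>s\<^sub>b poly_class X Q = (\<Union>s\<in>[nf P]\<^sub>A\<^sub>C. \<Union>t\<in>[nf Q]\<^sub>A\<^sub>C. [s \<^bold>+ t]\<^sub>A\<^sub>C)"
    unfolding poly_class_nf[OF assms(1), symmetric] poly_class_nf[OF assms(2), symmetric]
    using assms False by (simp add: sb_plus_def poly_class_inject forests.empty ac_class_const(1)[of X])
  also have "\<dots> = [nf P \<^bold>+ nf Q]\<^sub>A\<^sub>C"
    by (rule Union_ac_class) (rule ac_eq_plus_cong)
  finally show ?thesis using assms by (simp add: ac_class_PT[OF *] forest_of_nf)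
qed

text \<open>The left factor is restricted to monomials and \<open>1\<close> because a product of other polynomials in the
  sense of \<open>\<times>\<^sub>s\<^sub>b\<close> is not a polynomial.\<close>

lemma sb_times_poly_class:
  assumes "m \<in> monomial_forests X \<union> {unit}" "Q \<in> forests X"
  shows "poly_class X m \<times>\<^sub>s\<^sub>b poly_class X Q = poly_class X (m \<odot> Q)"
proof -
  have m: "m \<in> forests X" "m \<noteq> {#}"
    using assms monomial_forests_props by (auto simp: forests.Leaf)
  show ?thesis
  proof (cases "Q = {#} \<or> m = unit \<or> Q = unit")
    case True
    then show ?thesis using assms m
      by (auto simp: sb_times_def poly_class_inject forests.empty forests.Leaf
          ac_class_const[of X] times_unit_right)
  next
    case False
    then obtain s where s: "s \<in> monomial_terms X" "m = forest_of s"
      using assms by (auto simp flip: forest_of_monomial_terms)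
    have [simp]: "nf Q \<noteq> \<^bold>0" "nf Q \<noteq> \<^bold>1"
      using False forest_of_nf[OF assms(2)] by auto
    have *: "s \<^bold>\<times> nf Q \<in> PT X"
      using assms s by (auto simp: nf_PT)
    have sX: "[s]\<^sub>A\<^sub>C = poly_class X m" "[nf Q]\<^sub>A\<^sub>C = poly_class X Q"
      using s assms(2) by (auto simp: ac_class_PT[of s X] monomial_terms_PT poly_class_nf)
    have "poly_class X m \<times>\<^sub>s\<^sub>b poly_class X Q = (\<Union>s\<in>[s]\<^sub>A\<^sub>C. \<Union>t\<in>[nf Q]\<^sub>A\<^sub>C. [s \<^bold>\<times> t]\<^sub>A\<^sub>C)"
      unfolding sX using assms(2) m False
      by (simp add: sb_times_def poly_class_inject forests.empty forests.Leaf ac_class_const[of X])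
    also have "\<dots> = [s \<^bold>\<times> nf Q]\<^sub>A\<^sub>C"
      by (rule Union_ac_class) (rule ac_eq_times_cong)
    finally show ?thesis using assms s by (simp add: ac_class_PT[OF *] forest_of_nf)
  qed
qed

lemma forests_sum_list: "set Ps \<subseteq> forests X \<Longrightarrow> sum_list Ps \<in> forests X"
  by (induction Ps) (auto simp: forests.empty)

lemma sb_sum_poly_class:
  "set Ps \<subseteq> forests X \<Longrightarrow> sb_sum (map (poly_class X) Ps) = poly_class X (sum_list Ps)"
  unfolding sb_sum_def
  by (induction Ps) (auto simp: ac_class_const(1)[of X] sb_plus_poly_class forests_sum_list)

lemma polynomials_eq: "polynomials X = poly_class X ` forests X"
proof
  show "polynomials X \<subseteq> poly_class X ` forests X"
    unfolding polynomials_def using ac_class_PT forest_of_forests by blast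
  show "poly_class X ` forests X \<subseteq> polynomials X"
    unfolding polynomials_def using poly_class_nf nf_PT by blast
qed

section \<open>Right-distributive multiplication\<close>

lemma monomials_eq: "monomials X = poly_class X ` monomial_forests X"
proof -
  have "monomials X = (\<lambda>s. [s]\<^sub>A\<^sub>C) ` monomial_terms X" by (auto simp: monomials_def)
  also have "\<dots> = (\<lambda>s. poly_class X (forest_of s)) ` monomial_terms X"
    by (rule image_cong) (auto simp: ac_class_PT monomial_terms_PT)
  finally show ?thesis by (simp add: image_image flip: forest_of_monomial_terms)
qed

lemma sum_polynomials_eq: "sum_polynomials X = poly_class X ` {P \<in> forests X. size P \<ge> 2}"
proof (intro Set.set_eqI iffI)
  fix q assume "q \<in> sum_polynomials X"
  then obtain s t where st: "s \<in> PT X" "t \<in> PT X" "s \<noteq> \<^bold>0" "t \<noteq> \<^bold>0" "q = [s \<^bold>+ t]\<^sub>A\<^sub>C"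
    by (auto simp: sum_polynomials_def)
  then have "q = poly_class X (forest_of s + forest_of t)" using ac_class_PT[of "s \<^bold>+ t" X] by simp
  moreover have "size (forest_of s) \<noteq> 0" "size (forest_of t) \<noteq> 0" using st by (simp_all add: forest_of_PT_eq_empty)
  then have "size (forest_of s + forest_of t) \<ge> 2" unfolding size_union by linarith
  ultimately show "q \<in> poly_class X ` {P \<in> forests X. size P \<ge> 2}"
    using st by (auto simp: forest_of_forests intro!: image_eqI[of _ _ "forest_of s + forest_of t"])
next
  fix q assume "q \<in> poly_class X ` {P \<in> forests X. size P \<ge> 2}"
  then obtain P where P: "P \<in> forests X" "size P \<ge> 2" "q = poly_class X P" by blast
  then have "P \<noteq> {#}" by auto
  then obtain b Q where Q: "P = {#b#} + Q" using multi_nonempty_split[of P] by auto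
  then have ne: "Q \<noteq> {#}" using P by auto
  from P(1) have f: "{#b#} \<in> forests X" "Q \<in> forests X" unfolding Q forests_plus by auto
  then have *: "nf {#b#} \<in> PT X" "nf Q \<in> PT X" by (auto dest: nf_PT simp del: nf_single)
  moreover have "nf {#b#} \<noteq> \<^bold>0" "nf Q \<noteq> \<^bold>0"
    using forest_of_nf[OF f(1)] forest_of_nf[OF f(2)] ne by auto
  ultimately have "[nf {#b#} \<^bold>+ nf Q]\<^sub>A\<^sub>C \<in> sum_polynomials X"
    unfolding sum_polynomials_def by blast
  moreover have "[nf {#b#} \<^bold>+ nf Q]\<^sub>A\<^sub>C = q"
    using ac_class_PT[of "nf {#b#} \<^bold>+ nf Q" X] * \<open>nf {#b#} \<noteq> \<^bold>0\<close> \<open>nf Q \<noteq> \<^bold>0\<close> P Q f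
    by (simp add: forest_of_nf del: nf_single)
  ultimately show "q \<in> sum_polynomials X" by simp
qed

lemma product_polynomials_eq:
  "product_polynomials X =
    poly_class X ` {{#Edge x P#} | x P. x \<in> X \<and> P \<in> forests X \<and> P \<noteq> {#} \<and> P \<noteq> unit}"
proof (intro Set.set_eqI iffI)
  fix q assume "q \<in> product_polynomials X"
  then obtain s t where st: "s \<in> monomial_terms X" "t \<in> PT X" "t \<noteq> \<^bold>0" "t \<noteq> \<^bold>1" "q = [s \<^bold>\<times> t]\<^sub>A\<^sub>C"
    by (auto simp: product_polynomials_def)
  then have q: "q = poly_class X (forest_of s \<odot> forest_of t)" using ac_class_PT[of "s \<^bold>\<times> t" X] by simp
  have *: "\<exists>x P. forest_of s \<odot> R = {#Edge x P#} \<and> x \<in> X \<and> P \<in> forests X \<and> P \<noteq> {#} \<and> P \<noteq> unit"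
    if "R \<in> forests X" "R \<noteq> {#}" "R \<noteq> unit" for R
    using st(1) that
  proof (induction s arbitrary: R rule: monomial_terms.induct)
    case (1 x)
    then show ?case by (auto simp: times_Edge graft_def)
  next
    case (2 s t)
    from "2.IH"(2)[OF "2.prems"] obtain x P where
      "forest_of t \<odot> R = {#Edge x P#}" "x \<in> X" "P \<in> forests X" "P \<noteq> {#}" by blast
    with "2.IH"(1)[of "forest_of t \<odot> R"] show ?case by (simp add: forest_times_assoc)
  qed
  have "forest_of t \<in> forests X" "forest_of t \<noteq> {#}" "forest_of t \<noteq> unit"
    using st by (auto simp: forest_of_forests forest_of_PT_eq_empty[of t X] forest_of_PT_eq_unit[of t X])
  from *[OF this] show "q \<in> poly_class X ` {{#Edge x P#} | x P. x \<in> X \<and> P \<in> forests X \<and> P \<noteq> {#} \<and> P \<noteq> unit}"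
    unfolding q by blast
next
  fix q assume "q \<in> poly_class X ` {{#Edge x P#} | x P. x \<in> X \<and> P \<in> forests X \<and> P \<noteq> {#} \<and> P \<noteq> unit}"
  then obtain x P where P: "q = poly_class X {#Edge x P#}" "x \<in> X" "P \<in> forests X" "P \<noteq> {#}" "P \<noteq> unit"
    by blast
  have ne: "nf P \<noteq> \<^bold>0" "nf P \<noteq> \<^bold>1" using forest_of_nf[OF P(3)] P by auto
  then have "q = [TVar x \<^bold>\<times> nf P]\<^sub>A\<^sub>C"
    using ac_class_PT[of "TVar x \<^bold>\<times> nf P" X] P by (simp add: nf_PT forest_of_nf times_Edge graft_def)
  moreover have "[TVar x \<^bold>\<times> nf P]\<^sub>A\<^sub>C \<in> product_polynomials X"
    unfolding product_polynomials_def using P(2) ne nf_PT[OF P(3)] monomial_terms.intros(1)[of x X]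
    by blast
  ultimately show "q \<in> product_polynomials X" by simp
qed

lemma generators_eq: "generators X = poly_class X ` {{#Edge x unit#} | x. x \<in> X}"
  unfolding generators_def using ac_class_PT[of "TVar _" X] by (auto simp: image_iff)

text \<open>The classes that may appear in the decomposition of a sum polynomial are exactly those of single
  branches. Therefore a decomposition is an enumeration of the branches of a forest, which is why it
  is unique up to permutation.\<close>

lemma summand_classes_eq:
  "product_polynomials X \<union> generators X \<union> {[\<^bold>1]\<^sub>A\<^sub>C} = poly_class X ` {{#b#} | b. {#b#} \<in> forests X}"
proof -
  have "{{#b#} | b. {#b#} \<in> forests X} =
    {{#Edge x P#} | x P. x \<in> X \<and> P \<in> forests X \<and> P \<noteq> {#} \<and> P \<noteq> unit} \<union>
    {{#Edge x unit#} | x. x \<in> X} \<union> {unit}" (is "?A = ?B")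
  proof (intro Set.set_eqI iffI)
    fix P assume "P \<in> ?A"
    then obtain b where "P = {#b#}" "{#b#} \<in> forests X" by blast
    then show "P \<in> ?B" by (cases b) auto
  qed (auto simp: forests.Leaf)
  then show ?thesis
    unfolding product_polynomials_eq generators_eq ac_class_const[of X] by (simp add: image_Un)
qed

text \<open>A leaf has positive weight, so that each branch of a forest with several branches is lighter
  than the forest.\<close>

primrec branch_weight :: "'a branch \<Rightarrow> nat" where
  "branch_weight Leaf = 1"
| "branch_weight (Edge x P) = Suc (\<Sum>\<^sub># (image_mset branch_weight P))"

definition weight :: "'a forest \<Rightarrow> nat" where
  "weight P = \<Sum>\<^sub># (image_mset branch_weight P)"

lemma weight_simps [simp]:
  "weight {#} = 0" "weight unit = 1" "weight {#Edge x P#} = Suc (weight P)"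
  "weight (P + Q) = weight P + weight Q"
  by (simp_all add: weight_def)

lemma weight_add_mset: "weight (add_mset b P) = weight {#b#} + weight P"
  by (simp add: weight_def)

lemma weight_eq_0 [simp]: "weight P = 0 \<longleftrightarrow> P = {#}"
  by (induction P rule: forest_induct) auto

lemma weight_times:
  "P \<in> forests X \<Longrightarrow> P \<noteq> {#} \<Longrightarrow> weight R \<le> weight (P \<odot> R)"
proof (induction rule: forests.induct)
  case (Edge x P)
  then show ?case by (cases "R = {#}") (auto simp: times_Edge graft_def times_eq_empty)
next
  case (plus P Q)
  then show ?case by (cases "P = {#}") (auto simp: times_plus_left)
qed auto

lemma weight_monomial_times:
  assumes "m \<in> monomial_forests X" "R \<noteq> {#}"
  shows "weight R < weight (m \<odot> R)"
  using assms(1)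
proof cases
  case (var x)
  with assms show ?thesis by (simp add: times_Edge graft_def)
next
  case (Edge x n)
  then have "n \<in> forests X" "n \<noteq> {#}" using monomial_forests_props by auto
  with Edge assms weight_times[of n X R] show ?thesis
    by (simp add: times_Edge graft_def times_eq_empty)
qed

text \<open>Following a branch downwards until it forks yields the decomposition \<open>m \<times> q'\<close> of a product
  polynomial; a branch that never forks is a monomial.\<close>

lemma split_monomial_prefix:
  assumes "{#Edge x P#} \<in> forests X" "{#Edge x P#} \<notin> monomial_forests X"
  shows "\<exists>m\<in>monomial_forests X. \<exists>Q\<in>forests X. size Q \<ge> 2 \<and> {#Edge x P#} = m \<odot> Q"
  using assms
proof (induction "Edge x P" arbitrary: x P)
  case (Edge x P)
  from Edge.prems have xP: "x \<in> X" "P \<in> forests X" "P \<noteq> {#}" by auto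
  show ?case
  proof (cases "size P \<ge> 2")
    case True
    then show ?thesis using xP
      by (intro bexI[of _ "{#Edge x unit#}"] bexI[of _ P])
        (auto simp: times_Edge graft_def monomial_forests.var)
  next
    case False
    with xP have "size P = 1" by (cases "size P") (auto simp: numeral_2_eq_2)
    then obtain b where b: "P = {#b#}" using size_1_singleton_mset by blast
    have "P \<notin> monomial_forests X" "b \<noteq> Leaf"
      using Edge.prems xP b by (auto intro: monomial_forests.var monomial_forests.Edge)
    then obtain y P' where P': "b = Edge y P'" by (cases b) auto
    with Edge.hyps[of y P'] b xP \<open>P \<notin> monomial_forests X\<close> obtain m Q where
      "m \<in> monomial_forests X" "Q \<in> forests X" "size Q \<ge> 2" "P = m \<odot> Q" by auto
    then show ?thesis using xP
      by (intro bexI[of _ "{#Edge x m#}"] bexI[of _ Q])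
        (auto simp: times_Edge graft_def intro: monomial_forests.Edge)
  qed
qed

lemma sum_list_singletons: "sum_list (map (\<lambda>b. {#b#}) bs) = mset bs"
  by (induction bs) auto

lemma sum_list_times: "sum_list Ps \<odot> R = sum_list (map (\<lambda>P. P \<odot> R) Ps)"
  by (induction Ps) (simp_all add: times_plus_left)

text \<open>The recursion of the multiplication ends because both the summands of a sum and the
  factor \<open>q'\<close> of \<open>m \<times> q'\<close> have smaller weight.\<close>

lemma rd_graph_poly_class:
  assumes "Q \<in> forests X" "R \<in> forests X"
  shows "rd_graph X (poly_class X Q) (poly_class X R) (poly_class X (Q \<odot> R))"
  using assms(1)
proof (induction "weight Q" arbitrary: Q rule: less_induct)
  case less
  have poly: "poly_class X Q \<in> polynomials X" "poly_class X R \<in> polynomials X"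
    using less.prems assms(2) by (auto simp: polynomials_eq)
  show ?case
  proof (cases "R = {#} \<or> R = unit \<or> Q = {#} \<or> Q = unit")
    case True
    then show ?thesis
      using rd_graph.zero_left[of _ X] rd_graph.zero_right[of _ X] rd_graph.one_left[of _ X]
        rd_graph.one_right[of _ X] poly less.prems
      unfolding ac_class_const[of X] by (auto simp: times_unit_right)
  next
    case False
    then have R: "poly_class X R \<in> polynomials X - {[\<^bold>0]\<^sub>A\<^sub>C, [\<^bold>1]\<^sub>A\<^sub>C}"
      using poly assms(2) unfolding ac_class_const[of X]
      by (auto simp: poly_class_inject forests.empty forests.Leaf)
    consider "Q \<in> monomial_forests X" | "size Q \<ge> 2" | "Q \<notin> monomial_forests X" "size Q = 1"
      using False by (cases "size Q") (auto simp: numeral_2_eq_2 Suc_le_eq)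
    then show ?thesis
    proof cases
      case 1
      then have "rd_graph X (poly_class X Q) (poly_class X R) (poly_class X Q \<times>\<^sub>s\<^sub>b poly_class X R)"
        using R by (intro rd_graph.monomial) (auto simp: monomials_eq)
      then show ?thesis using 1 assms(2) by (simp add: sb_times_poly_class)
    next
      case 2
      obtain bs where bs: "mset bs = Q" using ex_mset by blast
      let ?qs = "map (\<lambda>b. poly_class X {#b#}) bs"
      let ?ps = "map (\<lambda>b. poly_class X ({#b#} \<odot> R)) bs"
      have b: "{#b#} \<in> forests X" if "b \<in> set bs" for b
        using less.prems bs that by (subst (asm) forests_iff) auto
      have "rd_graph X (poly_class X Q) (poly_class X R) (sb_sum ?ps)"
      proof (rule rd_graph.sum[where qs = ?qs])
        show "poly_class X Q \<in> sum_polynomials X" using 2 less.prems by (auto simp: sum_polynomials_eq)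
        show "poly_class X Q = sb_sum ?qs"
          using sb_sum_poly_class[of "map (\<lambda>b. {#b#}) bs" X] b bs 
          by (auto simp: sum_list_singletons comp_def)
        show "length ?qs \<ge> 2" using 2 bs by auto
        show "set ?qs \<subseteq> product_polynomials X \<union> generators X \<union> {[\<^bold>1]\<^sub>A\<^sub>C}"
          unfolding summand_classes_eq using b by auto
        have "rd_graph X (poly_class X {#b#}) (poly_class X R) (poly_class X ({#b#} \<odot> R))"
          if "b \<in> set bs" for b
        proof -
          have "b \<in># Q" using that bs by auto
          then obtain Q' where Q': "Q = add_mset b Q'" using multi_member_split by metis
          with 2 have "Q' \<noteq> {#}" by auto
          then have "weight {#b#} < weight Q" 
            unfolding Q' weight_add_mset[of b Q'] by (simp add: neq0_conv[symmetric] del: neq0_conv)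
          then show ?thesis using b[OF that] by (rule less.hyps)
        qed
        then show "list_all2 (\<lambda>q p. rd_graph X q (poly_class X R) p) ?qs ?ps"
          by (simp add: list_all2_conv_all_nth)
      qed (rule R)
      moreover have "set (map (\<lambda>b. {#b#} \<odot> R) bs) \<subseteq> forests X"
        using b assms(2) by (auto intro!: forests_times)
      then have "sb_sum ?ps = poly_class X (sum_list (map (\<lambda>b. {#b#} \<odot> R) bs))"
        by (subst sb_sum_poly_class[symmetric]) (simp_all add: comp_def)
      moreover have "sum_list (map (\<lambda>b. {#b#} \<odot> R) bs) = Q \<odot> R"
        using sum_list_times[of "map (\<lambda>b. {#b#}) bs" R] bs by (simp add: sum_list_singletons comp_def)
      ultimately show ?thesis by simp
    next
      case 3
      then obtain b where Qb: "Q = {#b#}" using size_1_singleton_mset by blast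
      with False obtain x P where b: "b = Edge x P" by (cases b) auto
      obtain m Q' where m: "m \<in> monomial_forests X" "Q' \<in> forests X" "size Q' \<ge> 2" "Q = m \<odot> Q'"
        using split_monomial_prefix[of x P X] 3 less.prems unfolding Qb b by blast
      then have "Q' \<noteq> {#}" by auto
      then have "weight Q' < weight Q" using m weight_monomial_times by blast
      then have "rd_graph X (poly_class X Q') (poly_class X R) (poly_class X (Q' \<odot> R))"
        using m(2) by (rule less.hyps)
      with m R have "rd_graph X (poly_class X Q) (poly_class X R)
          (poly_class X m \<times>\<^sub>s\<^sub>b poly_class X (Q' \<odot> R))"
        by (intro rd_graph.product[where q' = "poly_class X Q'"])
          (auto simp: monomials_eq sum_polynomials_eq sb_times_poly_class)
      then show ?thesis using m assms(2) by (simp add: sb_times_poly_class forests_times forest_times_assoc)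
    qed
  qed
qed

text \<open>Each rule of the graph is a valid identity for \<open>\<odot>\<close>, for whatever decomposition it uses. Hence all
  decompositions lead to the same result, and the graph is functional.\<close>

lemma rd_graph_sound:
  assumes "rd_graph X q r p"
  shows "\<exists>Q\<in>forests X. \<exists>R\<in>forests X.
    q = poly_class X Q \<and> r = poly_class X R \<and> p = poly_class X (Q \<odot> R)"
  using assms
proof (induction rule: rd_graph.induct)
  case (zero_right q)
  then obtain Q where "Q \<in> forests X" "q = poly_class X Q" unfolding polynomials_eq by blast
  then show ?case unfolding ac_class_const[of X]
    by (intro bexI[of _ "Q"] bexI[of _ "{#}"]) (auto simp: forests.empty forests.Leaf times_unit_right)
next
  case (zero_left q)
  then obtain Q where "Q \<in> forests X" "q = poly_class X Q" unfolding polynomials_eq by blast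
  then show ?case unfolding ac_class_const[of X]
    by (intro bexI[of _ "{#}"] bexI[of _ "Q"]) (auto simp: forests.empty forests.Leaf times_unit_right)
next
  case (one_right q)
  then obtain Q where "Q \<in> forests X" "q = poly_class X Q" unfolding polynomials_eq by blast
  then show ?case unfolding ac_class_const[of X]
    by (intro bexI[of _ "Q"] bexI[of _ "unit"]) (auto simp: forests.empty forests.Leaf times_unit_right)
next
  case (one_left q)
  then obtain Q where "Q \<in> forests X" "q = poly_class X Q" unfolding polynomials_eq by blast
  then show ?case unfolding ac_class_const[of X]
    by (intro bexI[of _ "unit"] bexI[of _ "Q"]) (auto simp: forests.empty forests.Leaf times_unit_right)
next
  case (monomial q r)
  then obtain Q R where "q = poly_class X Q" "Q \<in> monomial_forests X" "r = poly_class X R" "R \<in> forests X"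
    unfolding monomials_eq polynomials_eq by blast
  then show ?case using sb_times_poly_class[of Q X R] monomial_forests_props[of Q X] by blast
next
  case (sum q r qs ps)
  then obtain R where R: "R \<in> forests X" "r = poly_class X R" unfolding polynomials_eq by blast
  have "\<exists>Qs. set Qs \<subseteq> forests X \<and> qs = map (poly_class X) Qs \<and> ps = map (\<lambda>Q. poly_class X (Q \<odot> R)) Qs"
    using sum.IH
  proof (induction rule: list_all2_induct)
    case (Cons q qs p ps)
    then obtain Qs Q R' where Q: "set Qs \<subseteq> forests X" "qs = map (poly_class X) Qs"
      "ps = map (\<lambda>Q. poly_class X (Q \<odot> R)) Qs" "Q \<in> forests X" "R' \<in> forests X"
      "q = poly_class X Q" "r = poly_class X R'" "p = poly_class X (Q \<odot> R')" by blast
    moreover have "R' = R" using Q R by (simp add: poly_class_inject)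
    ultimately show ?case by (intro exI[of _ "Q # Qs"]) auto
  qed simp
  then obtain Qs where Qs: "set Qs \<subseteq> forests X" "qs = map (poly_class X) Qs"
    "ps = map (\<lambda>Q. poly_class X (Q \<odot> R)) Qs" by blast
  have "set (map (\<lambda>Q. Q \<odot> R) Qs) \<subseteq> forests X" using Qs(1) R by (auto intro: forests_times)
  then have "sb_sum ps = poly_class X (sum_list (map (\<lambda>Q. Q \<odot> R) Qs))"
    unfolding Qs(3) by (subst sb_sum_poly_class[symmetric]) (simp_all add: comp_def)
  also have "sum_list (map (\<lambda>Q. Q \<odot> R) Qs) = sum_list Qs \<odot> R"
    by (rule sum_list_times[symmetric])
  finally have "sb_sum ps = poly_class X (sum_list Qs \<odot> R)" .
  moreover have "q = sb_sum qs" by (rule sum.hyps)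
  then have "q = poly_class X (sum_list Qs)"
    unfolding Qs(2) by (simp add: sb_sum_poly_class Qs(1))
  ultimately show ?case using R forests_sum_list[OF Qs(1)]
    by (intro bexI[of _ "sum_list Qs"] bexI[of _ R]) simp_all
next
  case (product m q' r q p)
  then obtain Q' R M where Q': "Q' \<in> forests X" "R \<in> forests X" "q' = poly_class X Q'"
    "r = poly_class X R" "p = poly_class X (Q' \<odot> R)" "m = poly_class X M" "M \<in> monomial_forests X"
    unfolding monomials_eq by blast
  then have "m \<times>\<^sub>s\<^sub>b p = poly_class X (M \<odot> Q' \<odot> R)" "q = poly_class X (M \<odot> Q')"
    using product.hyps by (simp_all add: sb_times_poly_class forests_times forest_times_assoc)
  moreover have "M \<odot> Q' \<in> forests X"
    using Q' monomial_forests_props[of M X] by (simp add: forests_times)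
  ultimately show ?case using Q' by (intro bexI[of _ "M \<odot> Q'"] bexI[of _ R]) simp_all
qed

lemma rd_times_poly_class:
  assumes "Q \<in> forests X" "R \<in> forests X"
  shows "rd_times X (poly_class X Q) (poly_class X R) = poly_class X (Q \<odot> R)"
  unfolding rd_times_def
proof (rule the_equality)
  show "rd_graph X (poly_class X Q) (poly_class X R) (poly_class X (Q \<odot> R))"
    using assms by (rule rd_graph_poly_class)
  show "p = poly_class X (Q \<odot> R)" if "rd_graph X (poly_class X Q) (poly_class X R) p" for p
    using rd_graph_sound[OF that] assms by (auto simp: poly_class_inject)
qed

section \<open>Id-reduced polynomials\<close>

text \<open>Only the top level is concerned; \<open>reduced_branch\<close> imposes the condition at all levels.\<close>

definition distinct_forest :: "'a forest \<Rightarrow> bool" where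
  "distinct_forest P \<longleftrightarrow> (\<forall>b. count P b \<le> 1)"

lemma distinct_forest_simps [simp]: "distinct_forest {#}" "distinct_forest {#b#}"
  by (auto simp: distinct_forest_def)

lemma distinct_forest_add_mset [simp]:
  "distinct_forest (add_mset b P) \<longleftrightarrow> b \<notin># P \<and> distinct_forest P"
proof
  assume *: "distinct_forest (add_mset b P)"
  have "count P c \<le> 1" for c
    using *[unfolded distinct_forest_def, rule_format, of c] by (simp split: if_splits)
  moreover have "count P b = 0"
    using *[unfolded distinct_forest_def, rule_format, of b] by simp
  ultimately show "b \<notin># P \<and> distinct_forest P"
    by (simp add: distinct_forest_def not_in_iff)
next
  assume "b \<notin># P \<and> distinct_forest P"
  then show "distinct_forest (add_mset b P)"
    by (simp add: distinct_forest_def not_in_iff)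
qed

lemma distinct_forest_plus:
  "distinct_forest (P + Q) \<longleftrightarrow> distinct_forest P \<and> distinct_forest Q \<and> set_mset P \<inter> set_mset Q = {}"
  by (induction P) auto

lemma distinct_forest_mset: "distinct_forest (mset bs) \<longleftrightarrow> distinct bs"
  by (induction bs) auto

lemma distinct_forest_sup [simp]:
  "distinct_forest P \<Longrightarrow> distinct_forest Q \<Longrightarrow> distinct_forest (P \<union># Q)"
  by (auto simp: distinct_forest_def)

lemma distinct_forest_eqI:
  assumes "distinct_forest P" "distinct_forest Q" "set_mset P = set_mset Q"
  shows "P = Q"
proof (rule multiset_eqI)
  fix b
  have "count P b \<le> 1" "count Q b \<le> 1" "count P b = 0 \<longleftrightarrow> count Q b = 0"
    using assms by (simp_all add: distinct_forest_def count_eq_zero_iff)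
  then show "count P b = count Q b" by linarith
qed

inductive reduced_branch :: "'a set \<Rightarrow> 'a branch \<Rightarrow> bool" for X where
  Leaf: "reduced_branch X Leaf"
| Edge: "x \<in> X \<Longrightarrow> P \<noteq> {#} \<Longrightarrow> distinct_forest P \<Longrightarrow> (\<forall>b\<in>#P. reduced_branch X b) \<Longrightarrow>
    reduced_branch X (Edge x P)"

definition reduced_forests :: "'a set \<Rightarrow> 'a forest set" where
  "reduced_forests X = {P. distinct_forest P \<and> (\<forall>b\<in>#P. reduced_branch X b)}"

inductive_simps reduced_branch_simps: "reduced_branch X Leaf" "reduced_branch X (Edge x P)"

lemma reduced_branch_Leaf [simp]: "reduced_branch X Leaf"
  by (rule Leaf)

lemma reduced_branch_Edge [simp]:
  "reduced_branch X (Edge x P) \<longleftrightarrow> x \<in> X \<and> P \<noteq> {#} \<and> P \<in> reduced_forests X"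
  by (auto simp: reduced_forests_def reduced_branch_simps)

lemma reduced_forests_single [simp]: "{#b#} \<in> reduced_forests X \<longleftrightarrow> reduced_branch X b"
  by (simp add: reduced_forests_def)

lemma reduced_forests_empty [simp]: "{#} \<in> reduced_forests X"
  by (simp add: reduced_forests_def)

lemma reduced_forests_sup:
  "P \<in> reduced_forests X \<Longrightarrow> Q \<in> reduced_forests X \<Longrightarrow> P \<union># Q \<in> reduced_forests X"
  by (auto simp: reduced_forests_def)

lemma reduced_branch_forests: "reduced_branch X b \<Longrightarrow> {#b#} \<in> forests X"
proof (induction rule: reduced_branch.induct)
  case (Edge x P)
  then have "P \<in> forests X" using forests_iff[of P X] by blast
  with Edge show ?case by simp
qed (rule forests.Leaf)

lemma reduced_forests_forests: "P \<in> reduced_forests X \<Longrightarrow> P \<in> forests X"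
  using forests_iff[of P X] by (auto simp: reduced_forests_def reduced_branch_forests)

lemma monomial_forests_reduced:
  "m \<in> monomial_forests X \<Longrightarrow> \<exists>b. m = {#b#} \<and> reduced_branch X b"
  by (induction rule: monomial_forests.induct) auto

lemma weight_mono:
  assumes "b \<in># P"
  shows "weight {#b#} \<le> weight P"
proof -
  obtain Q where "P = add_mset b Q" using assms multi_member_split by metis
  then show ?thesis using weight_add_mset[of b Q] by simp
qed

text \<open>The branch \<open>Edge x (P \<odot> R)\<close> is heavier than all of \<open>R\<close>. This keeps the two kinds of branches
  of a product apart: those of \<open>R\<close> itself, from a leaf on the top level, and those
  obtained by substitution below an edge.\<close>

lemma Edge_times_notin:
  assumes "P \<in> forests X" "P \<noteq> {#}"
  shows "Edge x (P \<odot> R) \<notin># R"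
  using weight_times[OF assms, of R] weight_mono[of "Edge x (P \<odot> R)" R] by auto

lemma in_times_iff:
  assumes "P \<in> forests X" "R \<noteq> {#}"
  shows "b \<in># P \<odot> R \<longleftrightarrow> (Leaf \<in># P \<and> b \<in># R) \<or> (\<exists>x Q. Edge x Q \<in># P \<and> b = Edge x (Q \<odot> R))"
  using assms(1)
proof (induction rule: forests.induct)
  case (Edge x P)
  with assms(2) show ?case by (auto simp: times_Edge graft_def times_eq_empty)
qed (auto simp: times_plus_left)

text \<open>By \<open>Edge_times_notin\<close> one can read off \<open>P \<odot> R\<close> which branches come from edges of \<open>P\<close> and whether
  \<open>P\<close> has a leaf on the top level. Below an edge, induction on the weight applies.\<close>

lemma times_right_cancel:
  assumes "P \<in> reduced_forests X" "P' \<in> reduced_forests X" "R \<noteq> {#}" "P \<odot> R = P' \<odot> R"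
  shows "P = P'"
  using assms(1,2,4)
proof (induction "weight P" arbitrary: P P' rule: less_induct)
  case less
  note P = reduced_forests_forests[OF less.prems(1)] and P' = reduced_forests_forests[OF less.prems(2)]
  have IH: "Q = Q'" if "Edge x Q \<in># P" "Edge x' Q' \<in># P'" "Q \<odot> R = Q' \<odot> R" for x x' Q Q'
  proof (rule less.hyps)
    show "weight Q < weight P" using weight_mono[OF that(1)] by simp
  qed (use that less.prems in \<open>auto simp: reduced_forests_def\<close>)
  \<comment> \<open>If \<open>S'\<close> had no leaf on top, a branch of \<open>R\<close> would be heavier than \<open>R\<close>.\<close>
  have Leaf_P: "Leaf \<in># S'" if S: "Leaf \<in># S" "S \<in> forests X" "S' \<in> forests X" "S \<odot> R = S' \<odot> R"
    for S S' :: "'a forest"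
  proof (rule ccontr)
    assume no: "Leaf \<notin># S'"
    obtain b where b: "b \<in># R" using assms(3) by blast
    then have "b \<in># S' \<odot> R" using S(1) in_times_iff[OF S(2) assms(3)] unfolding S(4) by blast
    then obtain x Q where "Edge x Q \<in># S'" "b = Edge x (Q \<odot> R)"
      using no in_times_iff[OF S(3) assms(3)] by blast
    moreover from this(1) have "{#Edge x Q#} \<in> forests X" using forests_iff[of S' X] S by blast
    ultimately show False using b Edge_times_notin[of Q X x R] by simp
  qed
  have "set_mset P = set_mset P'"
  proof (intro Set.set_eqI iffI)
    fix b assume b: "b \<in># P"
    show "b \<in># P'"
    proof (cases b)
      case Leaf
      then show ?thesis using Leaf_P[of P P'] b P P' less.prems by simp
    next
      case (Edge x Q)
      then have "Edge x (Q \<odot> R) \<in># P' \<odot> R"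
        using in_times_iff[OF P assms(3)] b less.prems(3) by metis
      moreover have "Q \<in> forests X" "Q \<noteq> {#}" using P b Edge forests_iff[of P X] by fastforce+
      then have "Edge x (Q \<odot> R) \<notin># R" by (rule Edge_times_notin)
      ultimately obtain Q' where "Edge x Q' \<in># P'" "Q \<odot> R = Q' \<odot> R"
        using in_times_iff[OF P' assms(3)] by auto
      then show ?thesis using IH[of x Q x Q'] b Edge by simp
    qed
  next
    fix b assume b: "b \<in># P'"
    show "b \<in># P"
    proof (cases b)
      case Leaf
      then show ?thesis using Leaf_P[of P' P] b P P' less.prems by simp
    next
      case (Edge x Q)
      then have "Edge x (Q \<odot> R) \<in># P \<odot> R"
        using in_times_iff[OF P' assms(3)] b less.prems(3) by metis
      moreover have "Q \<in> forests X" "Q \<noteq> {#}" using P' b Edge forests_iff[of P' X] by fastforce+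
      then have "Edge x (Q \<odot> R) \<notin># R" by (rule Edge_times_notin)
      ultimately obtain Q' where "Edge x Q' \<in># P" "Q \<odot> R = Q' \<odot> R"
        using in_times_iff[OF P assms(3)] by auto
      then show ?thesis using IH[of x Q' x Q] b Edge by simp
    qed
  qed
  with less.prems show ?case by (auto simp: reduced_forests_def intro: distinct_forest_eqI)
qed

text \<open>Distinct branches of \<open>P\<close> produce disjoint sets of branches in \<open>P \<odot> R\<close>: two edges by right
  cancellation, a leaf and an edge by the weight argument. So \<open>\<times>\<^bsub>rd\<^esub>\<close> does not create equal
  summands, although it adds them up without removing duplicates.\<close>

lemma distinct_forest_times:
  assumes "P \<in> reduced_forests X" "R \<in> reduced_forests X"
  shows "distinct_forest (P \<odot> R)"
proof (cases "R = {#}")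
  case False
  show ?thesis using assms(1)
  proof (induction P)
    case (add b P)
    then have P: "P \<in> reduced_forests X" "b \<notin># P" "reduced_branch X b"
      by (auto simp: reduced_forests_def)
    have b: "{#b#} \<odot> R = (case b of Leaf \<Rightarrow> R | Edge x Q \<Rightarrow> {#Edge x (Q \<odot> R)#})"
      using P(3) False by (auto split: branch.split simp: times_Edge graft_def times_eq_empty[of _ X] reduced_forests_forests)
    have "c \<notin># {#b#} \<odot> R" if "c \<in># P \<odot> R" for c
      using that unfolding in_times_iff[OF reduced_forests_forests[OF P(1)] False]
    proof (elim disjE exE conjE)
      assume c: "Leaf \<in># P" "c \<in># R"
      then obtain x Q where "b = Edge x Q" using P by (cases b) auto
      then show ?thesis using b c P Edge_times_notin[of Q X x R] by (auto simp: reduced_forests_forests)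
    next
      fix x Q assume c: "Edge x Q \<in># P" "c = Edge x (Q \<odot> R)"
      then have Q: "Q \<in> reduced_forests X" "Q \<noteq> {#}" using P(1) by (auto simp: reduced_forests_def)
      show ?thesis
      proof (cases b)
        case Leaf
        then show ?thesis using Edge_times_notin[of Q X x R] Q c by (simp add: reduced_forests_forests)
      next
        case (Edge y Q')
        then show ?thesis using b c Q P times_right_cancel[of Q X Q' R] False by auto
      qed
    qed
    moreover have "distinct_forest ({#b#} \<odot> R)"
      unfolding b using assms(2) by (auto split: branch.split simp: reduced_forests_def)
    ultimately show ?case using add.IH[OF P(1)] by (auto simp: times_add_mset[of b P] distinct_forest_plus)
  qed simp
qed simp

lemma reduced_forests_times:
  assumes "P \<in> reduced_forests X" "R \<in> reduced_forests X"
  shows "P \<odot> R \<in> reduced_forests X"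
proof (cases "R = {#}")
  case False
  have *: "reduced_branch X b \<Longrightarrow> c \<in># {#b#} \<odot> R \<Longrightarrow> reduced_branch X c" for b c
  proof (induction arbitrary: c rule: reduced_branch.induct)
    case Leaf
    then show ?case using assms(2) by (simp add: reduced_forests_def)
  next
    case (Edge x P)
    then have P: "P \<in> reduced_forests X" by (auto simp: reduced_forests_def)
    have "reduced_branch X c" if c: "c \<in># P \<odot> R" for c
    proof -
      obtain b where "b \<in># P" "c \<in># {#b#} \<odot> R" using c by (auto simp: forest_times_def)
      then show ?thesis using Edge by blast
    qed
    moreover have "distinct_forest (P \<odot> R)" using P assms(2) by (rule distinct_forest_times)
    ultimately have "P \<odot> R \<in> reduced_forests X" by (simp add: reduced_forests_def)
    moreover have "P \<odot> R \<noteq> {#}" using Edge.hyps False times_eq_empty[OF reduced_forests_forests[OF P]] by blast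
    ultimately show ?case using Edge by (simp add: times_Edge graft_def)
  qed
  have "reduced_branch X c" if c: "c \<in># P \<odot> R" for c
  proof -
    obtain b where "b \<in># P" "c \<in># {#b#} \<odot> R" using c by (auto simp: forest_times_def)
    then show ?thesis using * assms(1) by (auto simp: reduced_forests_def)
  qed
  then show ?thesis using distinct_forest_times[OF assms] by (simp add: reduced_forests_def)
qed simp

lemma PT_no_forbidden_subterms:
  "t \<in> PT X \<Longrightarrow> t \<noteq> \<^bold>0 \<Longrightarrow>
    \<^bold>0 \<notin> subterms t \<and> (\<forall>s. \<^bold>1 \<^bold>\<times> s \<notin> subterms t \<and> s \<^bold>\<times> \<^bold>1 \<notin> subterms t)"
proof (induction t)
  case (TTimes s t)
  then show ?case using monomial_terms_PT[of s X] by auto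
qed auto

lemma PT_ST: "t \<in> PT X \<Longrightarrow> t \<in> ST X"
proof -
  have mono: "s \<in> monomial_terms X \<Longrightarrow> vars s \<subseteq> X" for s
    by (induction rule: monomial_terms.induct) auto
  have "t \<in> PT X \<Longrightarrow> vars t \<subseteq> X"
    by (induction rule: PT.induct) (auto dest: mono)
  then show "t \<in> PT X \<Longrightarrow> t \<in> ST X"
    using PT_no_forbidden_subterms by (auto simp: ST_def terms_def simple_def)
qed

lemma forest_of_summands: "forest_of t = sum_list (map forest_of (summands t))"
  by (induction t) auto

lemma summands_PT:
  "t \<in> PT X \<Longrightarrow> t \<noteq> \<^bold>0 \<Longrightarrow> u \<in> set (summands t) \<Longrightarrow> u \<in> PT X \<and> (\<exists>b. forest_of u = {#b#})"
proof (induction t)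
  case (TTimes s t)
  then show ?case using monomial_times_Edge[of s X "forest_of t"] by (auto simp: forest_of_PT_eq_empty)
qed auto

lemma ST_id_summands:
  assumes "t \<in> ST_id X"
  shows "(\<forall>u\<in>set (summands t). u \<in> ST_id X) \<and> sorted_wrt (\<lambda>u v. \<not> u =\<^sub>A\<^sub>C v) (summands t)"
  using assms
proof cases
  case monomial
  then show ?thesis using assms by cases auto
qed (use assms ST_id.zero ST_id.one in auto)

text \<open>The summands of a polynomial term are single branches, and AC-equality of summands is equality of
  branches.\<close>

lemma distinct_forest_summands:
  assumes "t \<in> PT X" "t \<noteq> \<^bold>0"
  shows "distinct_forest (forest_of t) \<longleftrightarrow> sorted_wrt (\<lambda>u v. \<not> u =\<^sub>A\<^sub>C v) (summands t)"
proof -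
  have "distinct_forest (sum_list (map forest_of ts)) \<longleftrightarrow> sorted_wrt (\<lambda>u v. \<not> u =\<^sub>A\<^sub>C v) ts"
    if "\<forall>u\<in>set ts. u \<in> PT X \<and> (\<exists>b. forest_of u = {#b#})" for ts
    using that
  proof (induction ts)
    case (Cons u ts)
    then obtain b where b: "u \<in> PT X" "forest_of u = {#b#}" by auto
    have "b \<in># sum_list (map forest_of ts) \<longleftrightarrow> (\<exists>v\<in>set ts. u =\<^sub>A\<^sub>C v)"
      using Cons.prems b by (induction ts) (auto simp: PT_ac_eq_iff)
    with Cons b show ?case by auto
  qed simp
  from this[of "summands t"] show ?thesis using summands_PT[OF assms] forest_of_summands[of t] by simp
qed

lemma in_sum_list_iff: "b \<in># sum_list Ps \<longleftrightarrow> (\<exists>P\<in>set Ps. b \<in># P)"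
  by (induction Ps) auto

lemma forest_of_ST_id: "t \<in> ST_id X \<Longrightarrow> t \<in> PT X \<Longrightarrow> forest_of t \<in> reduced_forests X"
proof (induction rule: ST_id.induct)
  case (monomial s)
  then have "forest_of s \<in> monomial_forests X" by (auto simp flip: forest_of_monomial_terms)
  then show ?case using monomial_forests_reduced by fastforce
next
  case (sum t)
  then have t: "t \<noteq> \<^bold>0" by (auto simp: sum_terms_def)
  have "reduced_branch X b" if "b \<in># forest_of t" for b
  proof -
    obtain u where u: "u \<in> set (summands t)" "b \<in># forest_of u"
      using \<open>b \<in># forest_of t\<close> unfolding forest_of_summands[of t] by (auto simp: in_sum_list_iff)
    with sum.IH summands_PT[OF sum.prems t u(1)] show ?thesis by (auto simp: reduced_forests_def)
  qed
  with sum t show ?case by (simp add: reduced_forests_def distinct_forest_summands)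
next
  case (product s t)
  then show ?case using monomial_terms_PT[of s X] by (auto intro!: reduced_forests_times)
qed auto

lemma monomial_times_reducedD:
  "s \<in> monomial_terms X \<Longrightarrow> R \<noteq> {#} \<Longrightarrow> forest_of s \<odot> R \<in> reduced_forests X \<Longrightarrow> R \<in> reduced_forests X"
proof (induction s arbitrary: R rule: monomial_terms.induct)
  case (2 s t)
  have "forest_of t \<odot> R \<noteq> {#}" using monomial_times_Edge[OF "2.hyps"(2) "2.prems"(1)] by auto
  with "2.IH"(1) "2.prems"(2) have "forest_of t \<odot> R \<in> reduced_forests X"
    by (simp add: forest_times_assoc)
  with "2.IH"(2) "2.prems"(1) show ?case by blast
qed (auto simp: times_Edge graft_def)

lemma ST_idI: "t \<in> PT X \<Longrightarrow> forest_of t \<in> reduced_forests X \<Longrightarrow> t \<in> ST_id X"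
proof (induction t)
  case (TPlus s t)
  then have "forest_of s \<in> reduced_forests X" "forest_of t \<in> reduced_forests X"
    by (auto simp: reduced_forests_def distinct_forest_plus)
  with TPlus have IH: "s \<in> ST_id X" "t \<in> ST_id X" by auto
  show ?case
  proof (rule ST_id.sum)
    show "s \<^bold>+ t \<in> sum_terms X" using TPlus.prems by (auto simp: sum_terms_def PT_ST)
    show "\<forall>u\<in>set (summands (s \<^bold>+ t)). u \<in> ST_id X" using IH ST_id_summands by auto
    have "distinct_forest (forest_of (s \<^bold>+ t))" using TPlus.prems(2) by (auto simp: reduced_forests_def)
    then show "sorted_wrt (\<lambda>u v. \<not> u =\<^sub>A\<^sub>C v) (summands (s \<^bold>+ t))"
      using distinct_forest_summands[OF TPlus.prems(1)] by simp
  qed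
next
  case (TTimes s t)
  then have "forest_of t \<in> reduced_forests X"
    using monomial_times_reducedD[of s X "forest_of t"] by (auto simp: forest_of_PT_eq_empty)
  with TTimes have t: "t \<in> ST_id X" "t \<notin> {\<^bold>0, \<^bold>1}" by auto
  have s: "s \<in> monomial_terms X" using TTimes.prems(1) by simp
  then have "s \<notin> {\<^bold>0, \<^bold>1}" using monomial_terms_PT by blast
  with s t show ?case by (intro ST_id.product[OF ST_id.monomial])
qed (auto intro: ST_id.zero ST_id.one ST_id.monomial)

text \<open>Being id-reduced is a property of the forest, hence of the AC class.\<close>

lemma PT_id_iff: "t \<in> PT_id X \<longleftrightarrow> t \<in> PT X \<and> forest_of t \<in> reduced_forests X"
  using forest_of_ST_id ST_idI by (auto simp: PT_id_def)

lemma id_polynomials_eq: "id_polynomials X = poly_class X ` reduced_forests X"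
proof
  show "id_polynomials X \<subseteq> poly_class X ` reduced_forests X"
    by (auto simp: id_polynomials_def PT_id_iff ac_class_PT)
  show "poly_class X ` reduced_forests X \<subseteq> id_polynomials X"
  proof
    fix q assume "q \<in> poly_class X ` reduced_forests X"
    then obtain P where P: "P \<in> reduced_forests X" "q = poly_class X P" by blast
    then have "nf P \<in> PT_id X" "q = [nf P]\<^sub>A\<^sub>C"
      by (auto simp: PT_id_iff nf_PT forest_of_nf[of P X] reduced_forests_forests poly_class_nf)
    then show "q \<in> id_polynomials X" by (auto simp: id_polynomials_def)
  qed
qed

lemma id_summand_classes_eq:
  "{[\<^bold>1]\<^sub>A\<^sub>C} \<union> monomials X \<union> (product_polynomials X \<inter> id_polynomials X) =
    poly_class X ` {{#b#} | b. reduced_branch X b}"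
proof (intro Set.set_eqI iffI)
  fix q assume "q \<in> {[\<^bold>1]\<^sub>A\<^sub>C} \<union> monomials X \<union> (product_polynomials X \<inter> id_polynomials X)"
  then consider "q = poly_class X unit" | "q \<in> monomials X" |
    "q \<in> product_polynomials X" "q \<in> id_polynomials X"
    unfolding ac_class_const[of X] by blast
  then show "q \<in> poly_class X ` {{#b#} | b. reduced_branch X b}"
  proof cases
    case 1
    then show ?thesis by auto
  next
    case 2
    then show ?thesis unfolding monomials_eq using monomial_forests_reduced by fast
  next
    case 3
    then obtain P b where *: "q = poly_class X {#b#}" "q = poly_class X P" "P \<in> reduced_forests X" "{#b#} \<in> forests X"
      unfolding product_polynomials_eq id_polynomials_eq by fastforce
    then have "P = {#b#}" by (simp add: poly_class_inject reduced_forests_forests)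
    with * show ?thesis by auto
  qed
next
  fix q assume "q \<in> poly_class X ` {{#b#} | b. reduced_branch X b}"
  then obtain b where b: "q = poly_class X {#b#}" "reduced_branch X b" by blast
  show "q \<in> {[\<^bold>1]\<^sub>A\<^sub>C} \<union> monomials X \<union> (product_polynomials X \<inter> id_polynomials X)"
  proof (cases b)
    case Leaf
    with b show ?thesis unfolding ac_class_const[of X] by simp
  next
    case (Edge x P)
    show ?thesis
    proof (cases "P = unit")
      case True
      with b Edge show ?thesis by (auto simp: monomials_eq monomial_forests.var)
    next
      case False
      with b Edge have "q \<in> product_polynomials X"
        by (auto simp: product_polynomials_eq reduced_forests_forests)
      moreover have "q \<in> id_polynomials X" using b unfolding id_polynomials_eq by auto
      ultimately show ?thesis by blast
    qed
  qed
qed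

lemma id_decomp_poly_class:
  assumes "Q \<in> reduced_forests X" "Q \<noteq> {#}"
  shows "id_decomp X (poly_class X Q) qs \<longleftrightarrow> (\<exists>bs. mset bs = Q \<and> qs = map (\<lambda>b. poly_class X {#b#}) bs)"
proof
  assume qs: "id_decomp X (poly_class X Q) qs"
  then have "\<forall>q\<in>set qs. \<exists>b. q = poly_class X {#b#} \<and> reduced_branch X b"
    unfolding id_decomp_def id_summand_classes_eq by blast
  then obtain f where f: "\<And>q. q \<in> set qs \<Longrightarrow> q = poly_class X {#f q#} \<and> reduced_branch X (f q)"
    by metis
  define bs where "bs = map f qs"
  have qs_eq: "qs = map (\<lambda>b. poly_class X {#b#}) bs"
    unfolding bs_def using f by (simp add: map_idI)
  have "set (map (\<lambda>b. {#b#}) bs) \<subseteq> forests X"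
    using f by (auto simp: bs_def reduced_branch_forests)
  note sb_sum_poly_class[OF this] and forests_sum_list[OF this]
  then have "sb_sum qs = poly_class X (mset bs)" "mset bs \<in> forests X"
    unfolding qs_eq by (simp_all add: comp_def sum_list_singletons)
  moreover have "poly_class X Q = sb_sum qs" using qs by (simp add: id_decomp_def)
  ultimately have "mset bs = Q" using assms by (simp add: poly_class_inject reduced_forests_forests)
  with qs_eq show "\<exists>bs. mset bs = Q \<and> qs = map (\<lambda>b. poly_class X {#b#}) bs" by blast
next
  assume "\<exists>bs. mset bs = Q \<and> qs = map (\<lambda>b. poly_class X {#b#}) bs"
  then obtain bs where bs: "mset bs = Q" "qs = map (\<lambda>b. poly_class X {#b#}) bs" by blast
  then have red: "reduced_branch X b" if "b \<in> set bs" for b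
    using assms that by (auto simp: reduced_forests_def)
  have "set (map (\<lambda>b. {#b#}) bs) \<subseteq> forests X" using red by (auto simp: reduced_branch_forests)
  from sb_sum_poly_class[OF this] have "poly_class X Q = sb_sum qs"
    unfolding bs(2) by (simp add: comp_def sum_list_singletons bs(1))
  moreover have "distinct bs" using assms bs by (simp add: reduced_forests_def distinct_forest_mset[symmetric])
  then have "distinct qs" unfolding bs(2) distinct_map
    using red by (auto simp: inj_on_def poly_class_inject reduced_branch_forests)
  moreover have "set qs \<subseteq> poly_class X ` {{#b#} | b. reduced_branch X b}" using red bs by auto
  ultimately show "id_decomp X (poly_class X Q) qs"
    unfolding id_decomp_def id_summand_classes_eq using assms(2) bs by auto
qed

text \<open>Every choice of decompositions enumerates the branches of \<open>Q\<close> and of \<open>R\<close>, and dropping from the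
  second list what occurs in the first leaves an enumeration of the union.\<close>

lemma id_plus_poly_class:
  assumes Q: "Q \<in> reduced_forests X" and R: "R \<in> reduced_forests X"
  shows "id_plus X (poly_class X Q) (poly_class X R) = poly_class X (Q \<union># R)"
proof (cases "Q = {#} \<or> R = {#}")
  case True
  then show ?thesis using assms
    by (auto simp: id_plus_def ac_class_const(1)[of X] poly_class_inject reduced_forests_forests forests.empty)
next
  case False
  then have ne: "Q \<noteq> {#}" "R \<noteq> {#}" by auto
  let ?f = "\<lambda>b. poly_class X {#b#}"
  have sum: "sb_sum (map ?f bs @ filter (\<lambda>r. r \<notin> set (map ?f bs)) (map ?f cs)) = poly_class X (Q \<union># R)"
    if bs: "mset bs = Q" and cs: "mset cs = R" for bs cs
  proof -
    have red: "reduced_branch X b" if "b \<in> set bs \<union> set cs" for b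
      using assms bs cs that by (auto simp: reduced_forests_def)
    have "?f c \<in> ?f ` set bs \<longleftrightarrow> c \<in> set bs" if "c \<in> set cs" for c
      using that red by (auto simp: poly_class_inject reduced_branch_forests)
    then have "filter (\<lambda>r. r \<notin> set (map ?f bs)) (map ?f cs) = map ?f (filter (\<lambda>c. c \<notin> set bs) cs)"
      by (simp add: filter_map comp_def cong: filter_cong)
    then have "sb_sum (map ?f bs @ filter (\<lambda>r. r \<notin> set (map ?f bs)) (map ?f cs)) =
        sb_sum (map ?f (bs @ filter (\<lambda>c. c \<notin> set bs) cs))" by simp
    also have "\<dots> = poly_class X (mset (bs @ filter (\<lambda>c. c \<notin> set bs) cs))"
    proof -
      have "set (map (\<lambda>b. {#b#}) (bs @ filter (\<lambda>c. c \<notin> set bs) cs)) \<subseteq> forests X"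
        using red by (auto simp: reduced_branch_forests)
      from sb_sum_poly_class[OF this] show ?thesis by (simp only: map_map comp_def sum_list_singletons)
    qed
    also have "mset (bs @ filter (\<lambda>c. c \<notin> set bs) cs) = Q \<union># R"
    proof (rule distinct_forest_eqI)
      have "distinct bs" "distinct cs"
        using assms bs cs by (simp_all add: reduced_forests_def distinct_forest_mset[symmetric])
      then show "distinct_forest (mset (bs @ filter (\<lambda>c. c \<notin> set bs) cs))"
        unfolding distinct_forest_mset by auto
      show "distinct_forest (Q \<union># R)" using assms by (simp add: reduced_forests_def)
      show "set_mset (mset (bs @ filter (\<lambda>c. c \<notin> set bs) cs)) = set_mset (Q \<union># R)"
        using bs cs by auto
    qed
    finally show ?thesis .
  qed
  obtain bs cs where bs: "mset bs = Q" "mset cs = R" using ex_mset by metis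
  have "(THE p. \<exists>qs rs. id_decomp X (poly_class X Q) qs \<and> id_decomp X (poly_class X R) rs \<and>
      p = sb_sum (qs @ filter (\<lambda>r. r \<notin> set qs) rs)) = poly_class X (Q \<union># R)"
  proof (rule the_equality)
    show "\<exists>qs rs. id_decomp X (poly_class X Q) qs \<and> id_decomp X (poly_class X R) rs \<and>
      poly_class X (Q \<union># R) = sb_sum (qs @ filter (\<lambda>r. r \<notin> set qs) rs)"
      unfolding id_decomp_poly_class[OF Q ne(1)] id_decomp_poly_class[OF R ne(2)]
      using sum[OF bs] bs by metis
    show "p = poly_class X (Q \<union># R)"
      if "\<exists>qs rs. id_decomp X (poly_class X Q) qs \<and> id_decomp X (poly_class X R) rs \<and>
      p = sb_sum (qs @ filter (\<lambda>r. r \<notin> set qs) rs)" for p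
      using that unfolding id_decomp_poly_class[OF Q ne(1)] id_decomp_poly_class[OF R ne(2)]
      using sum by blast
  qed
  then show ?thesis using assms ne
    by (simp add: id_plus_def ac_class_const(1)[of X] poly_class_inject reduced_forests_forests forests.empty)
qed

section \<open>Large polynomials\<close>

text \<open>Occurrence of a branch at any depth. Such a branch is a subpolynomial, and it stands
  for the subpolynomials of the form \<open>x \<times> q\<close> in the definition of large polynomials. An initial part
  of a monomial is a subpolynomial, too, but not a branch; \<open>large_subterm\<close> deals with it.\<close>

inductive occurs :: "'a branch \<Rightarrow> 'a forest \<Rightarrow> bool" for b where
  here: "b \<in># P \<Longrightarrow> occurs b P"
| deeper: "Edge x Q \<in># P \<Longrightarrow> occurs b Q \<Longrightarrow> occurs b P"

lemma occurs_mono: "occurs b P \<Longrightarrow> set_mset P \<subseteq> set_mset Q \<Longrightarrow> occurs b Q"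
  by (erule occurs.cases) (auto intro: occurs.intros)

lemma occurs_empty [simp]: "\<not> occurs b {#}"
  by (auto elim: occurs.cases)

lemma occurs_add_mset: "occurs b (add_mset c P) \<longleftrightarrow> occurs b {#c#} \<or> occurs b P"
  by (subst (1 2 3) occurs.simps) auto

lemma occurs_Leaf: "occurs b {#Leaf#} \<longleftrightarrow> b = Leaf"
  by (subst occurs.simps) auto

lemma occurs_Edge: "occurs b {#Edge x P#} \<longleftrightarrow> b = Edge x P \<or> occurs b P"
  by (subst occurs.simps) auto

lemma occurs_reduced:
  "occurs (Edge x Q) P \<Longrightarrow> P \<in> reduced_forests X \<Longrightarrow> reduced_branch X (Edge x Q)"
proof (induction P rule: occurs.induct)
  case (here P)
  then show ?case by (auto simp: reduced_forests_def)
next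
  case (deeper y Q' P)
  then have "reduced_branch X (Edge y Q')" by (auto simp: reduced_forests_def)
  with deeper.IH show ?case by simp
qed

text \<open>Substitution at the leaves transforms a branch together with everything below it. Only branches
  starting with an edge are considered, since a leaf disappears.\<close>

lemma occurs_times_right:
  "occurs (Edge x A) P \<Longrightarrow> P \<in> reduced_forests X \<Longrightarrow> R \<noteq> {#} \<Longrightarrow> occurs (Edge x (A \<odot> R)) (P \<odot> R)"
proof (induction P rule: occurs.induct)
  case (here P)
  then have "Edge x (A \<odot> R) \<in># P \<odot> R"
    using in_times_iff[OF reduced_forests_forests[of P X]] by blast
  then show ?case by (rule occurs.here)
next
  case (deeper y Q P)
  then have "Edge y (Q \<odot> R) \<in># P \<odot> R"
    using in_times_iff[OF reduced_forests_forests[of P X]] by blast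
  moreover have "reduced_branch X (Edge y Q)" using deeper by (auto simp: reduced_forests_def)
  then have "occurs (Edge x (A \<odot> R)) (Q \<odot> R)" using deeper by simp
  ultimately show ?case by (rule occurs.deeper)
qed

text \<open>Every nonempty forest has a leaf, and there the whole of \<open>R\<close> is found.\<close>

lemma occurs_times_left:
  "P \<in> forests X \<Longrightarrow> P \<noteq> {#} \<Longrightarrow> occurs b R \<Longrightarrow> occurs b (P \<odot> R)"
proof (induction rule: forests.induct)
  case (Edge x P)
  then have "R \<noteq> {#}" by auto
  with Edge show ?case by (auto simp: times_Edge graft_def times_eq_empty occurs_Edge)
next
  case (plus P Q)
  then show ?case
    by (cases "P = {#}") (auto simp: times_plus_left elim!: occurs_mono)
qed auto

lemma reduced_has_Edge:
  assumes "P \<in> reduced_forests X" "P \<noteq> {#}" "P \<noteq> unit"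
  obtains x Q where "Edge x Q \<in># P" "x \<in> X" "Q \<noteq> {#}" "Q \<in> reduced_forests X"
proof -
  have "\<exists>x Q. Edge x Q \<in># P"
  proof (rule ccontr)
    assume no: "\<not> ?thesis"
    have "b = Leaf" if "b \<in># P" for b using no that by (cases b) auto
    moreover obtain c where "c \<in># P" using assms(2) by blast
    ultimately have "set_mset P = set_mset unit" by auto
    then have "P = unit" using assms(1) by (intro distinct_forest_eqI) (auto simp: reduced_forests_def)
    with assms(3) show False by blast
  qed
  then obtain x Q where *: "Edge x Q \<in># P" by blast
  then have "reduced_branch X (Edge x Q)" using assms(1) by (auto simp: reduced_forests_def)
  with * show ?thesis using that by simp
qed

lemma times_ne_unit:
  assumes "P \<in> reduced_forests X" "P \<noteq> unit"
  shows "P \<odot> R \<noteq> unit"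
proof (cases "P = {#} \<or> R = {#}")
  case False
  then obtain x Q where "Edge x Q \<in># P" using reduced_has_Edge[OF assms(1)] assms(2) by metis
  then have "Edge x (Q \<odot> R) \<in># P \<odot> R"
    using False in_times_iff[OF reduced_forests_forests[OF assms(1)]] by blast
  then show ?thesis by auto
qed auto

text \<open>The sums \<open>y\<^sub>1 + \<dots> + y\<^sub>n\<close> of distinct elements of \<open>X \<union> {1}\<close>, at least one of them in \<open>X\<close>.\<close>

definition linear_forests :: "'a set \<Rightarrow> 'a forest set" where
  "linear_forests X = {A \<in> reduced_forests X. A \<noteq> {#} \<and> A \<noteq> unit \<and>
     (\<forall>b\<in>#A. b = Leaf \<or> (\<exists>y. b = Edge y unit))}"

text \<open>By right-distributivity \<open>A \<odot> P\<close> is the sum \<open>(y\<^sub>1 \<times> p') + \<dots> + (y\<^sub>n \<times> p')\<close> in the definition of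
  large polynomials. Writing it as a product makes its stability under multiplication from the right
  a matter of associativity.\<close>

definition large_forest :: "'a set \<Rightarrow> 'a forest \<Rightarrow> bool" where
  "large_forest X Q \<longleftrightarrow> (\<exists>x A P. A \<in> linear_forests X \<and> P \<in> reduced_forests X - {{#}, unit} \<and>
     occurs (Edge x (A \<odot> P)) Q)"

lemma large_forest_ne: "large_forest X Q \<Longrightarrow> Q \<noteq> {#} \<and> Q \<noteq> unit"
  by (auto simp: large_forest_def occurs_Leaf)

lemma large_forest_mono: "large_forest X P \<Longrightarrow> set_mset P \<subseteq> set_mset Q \<Longrightarrow> large_forest X Q"
  unfolding large_forest_def using occurs_mono by blast

text \<open>The pattern \<open>A \<odot> S\<close> becomes \<open>A \<odot> (S \<odot> R)\<close>.\<close>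

lemma large_forest_times_right:
  assumes "large_forest X P" "P \<in> reduced_forests X" "R \<in> reduced_forests X" "R \<noteq> {#}"
  shows "large_forest X (P \<odot> R)"
proof -
  obtain x A S where *: "A \<in> linear_forests X" "S \<in> reduced_forests X" "S \<noteq> {#}" "S \<noteq> unit"
    "occurs (Edge x (A \<odot> S)) P"
    using assms(1) by (auto simp: large_forest_def)
  have "occurs (Edge x (A \<odot> (S \<odot> R))) (P \<odot> R)"
    using occurs_times_right[OF *(5) assms(2,4)] by (simp add: forest_times_assoc)
  moreover have "S \<odot> R \<in> reduced_forests X - {{#}, unit}"
    using * assms times_ne_unit[OF *(2,4)] times_eq_empty[OF reduced_forests_forests[OF *(2)]]
    by (simp add: reduced_forests_times)
  ultimately show ?thesis unfolding large_forest_def using *(1) by blast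
qed

lemma large_forest_times_left:
  "P \<in> forests X \<Longrightarrow> P \<noteq> {#} \<Longrightarrow> large_forest X R \<Longrightarrow> large_forest X (P \<odot> R)"
  unfolding large_forest_def using occurs_times_left by blast

text \<open>A deepest edge ends in leaves only, and in a reduced forest it ends in one leaf.\<close>

lemma reduced_occurs_unit:
  "P \<in> reduced_forests X \<Longrightarrow> P \<noteq> {#} \<Longrightarrow> P \<noteq> unit \<Longrightarrow> \<exists>x. occurs (Edge x unit) P"
proof (induction "weight P" arbitrary: P rule: less_induct)
  case less
  obtain x Q where Q: "Edge x Q \<in># P" "Q \<noteq> {#}" "Q \<in> reduced_forests X"
    using reduced_has_Edge[OF less.prems] by metis
  show ?case
  proof (cases "Q = unit")
    case True
    with Q show ?thesis by (auto intro: occurs.here)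
  next
    case False
    have "weight Q < weight P" using weight_mono[OF Q(1)] by simp
    with less.hyps Q False obtain y where "occurs (Edge y unit) Q" by blast
    with Q(1) show ?thesis by (auto intro: occurs.deeper)
  qed
qed

text \<open>Descending along edges that are not followed by a single leaf ends in a linear forest: when no
  such edge is left, all branches are leaves or single variables.\<close>

lemma reduced_occurs_linear:
  "P \<in> reduced_forests X \<Longrightarrow> P \<noteq> {#} \<Longrightarrow> P \<noteq> unit \<Longrightarrow>
    P \<in> linear_forests X \<or> (\<exists>x. \<exists>A\<in>linear_forests X. occurs (Edge x A) P)"
proof (induction "weight P" arbitrary: P rule: less_induct)
  case less
  show ?case
  proof (cases "P \<in> linear_forests X")
    case False
    then obtain b where b: "b \<in># P" "b \<noteq> Leaf" "\<And>y. b \<noteq> Edge y unit"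
      using less.prems by (auto simp: linear_forests_def)
    then obtain x Q where Q: "Edge x Q \<in># P" "Q \<noteq> unit" by (cases b) auto
    moreover have "reduced_branch X (Edge x Q)" using Q less.prems by (auto simp: reduced_forests_def)
    moreover have "weight Q < weight P" using weight_mono[OF Q(1)] by simp
    ultimately have "Q \<in> linear_forests X \<or> (\<exists>x. \<exists>A\<in>linear_forests X. occurs (Edge x A) Q)"
      using less.hyps by simp
    with Q(1) show ?thesis by (blast intro: occurs.here occurs.deeper)
  qed simp
qed

text \<open>If \<open>Q\<close> is linear, the pattern with \<open>A = Q\<close> appears below an edge of \<open>P\<close> that ends in one leaf, and
  the outer factor \<open>P\<close> supplies this edge. Otherwise an edge of \<open>Q\<close> is followed by a
  linear forest, and the pattern appears already in \<open>Q \<odot> R\<close>.\<close>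

lemma large_triple_product:
  assumes "P \<in> reduced_forests X - {{#}, unit}" "Q \<in> reduced_forests X - {{#}, unit}"
    "R \<in> reduced_forests X - {{#}, unit}"
  shows "large_forest X (P \<odot> (Q \<odot> R))"
proof -
  have f: "P \<in> forests X" "Q \<in> forests X" and ne: "R \<noteq> {#}" "P \<noteq> {#}" "Q \<odot> R \<noteq> {#}"
    using assms times_eq_empty[of Q X R] by (auto simp: reduced_forests_forests)
  consider "Q \<in> linear_forests X" | x A where "A \<in> linear_forests X" "occurs (Edge x A) Q"
    using reduced_occurs_linear[of Q X] assms by blast
  then show ?thesis
  proof cases
    case 1
    obtain x where "occurs (Edge x unit) P" using reduced_occurs_unit[of P X] assms by blast
    then have "occurs (Edge x (unit \<odot> (Q \<odot> R))) (P \<odot> (Q \<odot> R))"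
      using assms(1) ne(3) by (intro occurs_times_right[of _ _ _ X]) auto
    with 1 assms(3) show ?thesis unfolding large_forest_def by auto
  next
    case 2
    then have "occurs (Edge x (A \<odot> R)) (Q \<odot> R)" using occurs_times_right[of x A Q X R] assms ne by blast
    with 2 assms(3) have "large_forest X (Q \<odot> R)" unfolding large_forest_def by blast
    then show ?thesis by (rule large_forest_times_left[OF f(1) ne(2)])
  qed
qed

lemma subterms_refl [simp]: "t \<in> subterms t"
  by (cases t) auto

lemma subterms_sum_trm: "t \<in> set ts \<Longrightarrow> subterms t \<subseteq> subterms (sum_trm ts)"
  by (induction ts rule: sum_trm.induct) auto

lemma subterms_nf: "b \<in># Q \<Longrightarrow> subterms (nf_branch b) \<subseteq> subterms (nf Q)"
proof -
  assume b: "b \<in># Q"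
  obtain ts where ts: "mset ts = image_mset nf_branch Q" "nf Q = sum_trm ts" by (rule nf_obtain)
  have "nf_branch b \<in># mset ts" unfolding ts(1) using b by simp
  then show ?thesis unfolding ts(2) using subterms_sum_trm by simp
qed

text \<open>Normal forms associate products to the right, so every branch that starts with an edge is
  visible as a subterm.\<close>

lemma nf_subterm: "occurs (Edge x P) Q \<Longrightarrow> nf_branch (Edge x P) \<in> subterms (nf Q)"
proof (induction Q rule: occurs.induct)
  case (here Q)
  then show ?case using subterms_nf subterms_refl by blast
next
  case (deeper y Q' Q)
  then have "Q' \<noteq> unit" by (auto simp: occurs_Leaf)
  then have "subterms (nf Q') \<subseteq> subterms (nf_branch (Edge y Q'))" by (auto simp: nf_branch_Edge)
  with deeper subterms_nf[of "Edge y Q'" Q] show ?case by blast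
qed

lemma large_pattern:
  assumes "x \<in> X" "set ys \<subseteq> TVar ` X \<union> {\<^bold>1}" "ys \<noteq> []" "P \<in> forests X" "P \<noteq> {#}"
  shows "[TVar x]\<^sub>A\<^sub>C \<times>\<^sub>s\<^sub>b sb_sum (map (\<lambda>y. [y]\<^sub>A\<^sub>C \<times>\<^sub>s\<^sub>b poly_class X P) ys) =
    poly_class X {#Edge x (sum_list (map forest_of ys) \<odot> P)#}"
proof -
  have y: "[y]\<^sub>A\<^sub>C = poly_class X (forest_of y)" "forest_of y \<in> monomial_forests X \<union> {unit}"
    "forest_of y \<in> forests X" "forest_of y \<noteq> {#}" if "y \<in> set ys" for y
    using that assms(2) ac_class_PT[of y X] by (auto simp: monomial_forests.var forests.Leaf)
  have "map (\<lambda>y. [y]\<^sub>A\<^sub>C \<times>\<^sub>s\<^sub>b poly_class X P) ys = map (poly_class X) (map (\<lambda>Q. Q \<odot> P) (map forest_of ys))"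
    using y assms(4) by (simp add: sb_times_poly_class)
  moreover have *: "set (map (\<lambda>Q. Q \<odot> P) (map forest_of ys)) \<subseteq> forests X"
    using y assms(4) by (auto intro: forests_times)
  ultimately have "sb_sum (map (\<lambda>y. [y]\<^sub>A\<^sub>C \<times>\<^sub>s\<^sub>b poly_class X P) ys) =
      poly_class X (sum_list (map forest_of ys) \<odot> P)"
    by (simp only: sb_sum_poly_class sum_list_times)
  moreover have "[TVar x]\<^sub>A\<^sub>C = poly_class X {#Edge x unit#}"
    using ac_class_PT[of "TVar x" X] assms(1) by simp
  moreover have f: "sum_list (map forest_of ys) \<in> forests X"
    using y by (intro forests_sum_list) auto
  moreover have "sum_list (map forest_of ys) \<noteq> {#}" using y assms(3) by (cases ys) auto
  then have "sum_list (map forest_of ys) \<odot> P \<noteq> {#}" using assms(5) times_eq_empty[OF f] by simp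
  ultimately show ?thesis using assms
    by (simp add: sb_times_poly_class monomial_forests.var forests_times times_Edge graft_def)
qed

lemma linear_forest_list:
  assumes "set ys \<subseteq> TVar ` X \<union> {\<^bold>1}" "distinct ys" "ys \<noteq> []" "hd ys \<in> TVar ` X"
  shows "sum_list (map forest_of ys) \<in> linear_forests X"
proof -
  define A where "A = sum_list (map forest_of ys)"
  have "distinct_forest A"
    unfolding A_def using assms(1,2)
  proof (induction ys)
    case (Cons y ys)
    have "set_mset (forest_of y) \<inter> set_mset (sum_list (map forest_of ys)) = {}"
      using Cons.prems by (auto simp: in_sum_list_iff)
    moreover have "distinct_forest (forest_of y)" using Cons.prems by auto
    ultimately show ?case using Cons by (simp add: distinct_forest_plus)
  qed simp
  moreover have b: "\<forall>b\<in>#A. b = Leaf \<or> (\<exists>y\<in>X. b = Edge y unit)"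
    unfolding A_def in_sum_list_iff using assms(1) by (fastforce simp: in_sum_list_iff)
  moreover obtain y zs where "ys = TVar y # zs" using assms(3,4) by (cases ys) auto
  then have "Edge y unit \<in># A" by (simp add: A_def)
  ultimately show ?thesis unfolding A_def[symmetric]
    by (auto simp: linear_forests_def reduced_forests_def)
qed

text \<open>The list has to start with a variable, so an edge of \<open>A\<close> is split off first and the other branches
  follow in any order.\<close>

lemma linear_forest_obtain_list:
  assumes "A \<in> linear_forests X"
  obtains ys where "set ys \<subseteq> TVar ` X \<union> {\<^bold>1}" "distinct ys" "ys \<noteq> []" "hd ys \<in> TVar ` X"
    "sum_list (map forest_of ys) = A"
proof -
  have A: "A \<in> reduced_forests X" "A \<noteq> {#}" "A \<noteq> unit" "\<forall>b\<in>#A. b = Leaf \<or> (\<exists>y. b = Edge y unit)"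
    using assms by (auto simp: linear_forests_def)
  then obtain y Q where "Edge y Q \<in># A" using reduced_has_Edge[of A X] by metis
  with A have "Edge y unit \<in># A" by auto
  then obtain B where B: "A = add_mset (Edge y unit) B" using multi_member_split by metis
  obtain bs where bs: "mset bs = B" using ex_mset by blast
  let ?bs = "Edge y unit # bs"
  have mset: "mset ?bs = A" by (simp add: bs B)
  have b: "nf_branch b \<in> TVar ` X \<union> {\<^bold>1} \<and> forest_of (nf_branch b) = {#b#}" if b: "b \<in> set ?bs" for b
  proof -
    have "b \<in># A" using b unfolding mset[symmetric] set_mset_mset .
    then have "b = Leaf \<or> (\<exists>y. b = Edge y unit)" "reduced_branch X b"
      using A by (auto simp: reduced_forests_def)
    then show ?thesis by (auto simp: nf_branch_Edge)
  qed
  have y: "y \<in> X" using A(1) B by (auto simp: reduced_forests_def)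
  show ?thesis
  proof (rule that[of "map nf_branch ?bs"])
    show "set (map nf_branch ?bs) \<subseteq> TVar ` X \<union> {\<^bold>1}" using b by auto
    have "distinct ?bs" using A(1) mset unfolding reduced_forests_def by (auto simp flip: distinct_forest_mset)
    moreover have "inj_on nf_branch (set ?bs)"
      by (rule inj_onI) (metis b single_eq_single)
    ultimately show "distinct (map nf_branch ?bs)" unfolding distinct_map by blast
    show "hd (map nf_branch ?bs) \<in> TVar ` X" using y by (simp add: nf_branch_Edge)
    have "map forest_of (map nf_branch ?bs) = map (\<lambda>b. {#b#}) ?bs" using b by simp
    then show "sum_list (map forest_of (map nf_branch ?bs)) = A" using mset by (simp only: sum_list_singletons)
  qed simp
qed

text \<open>A subterm of the monomial factor \<open>u\<close> of a product \<open>u \<times> v\<close> need not be a branch of the forest of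
  \<open>u \<times> v\<close>. But then the forest of \<open>u\<close> is large, and multiplication by \<open>v\<close> from the right preserves this.\<close>

lemma large_subterm:
  assumes "A \<in> linear_forests X" "P \<in> reduced_forests X" "P \<noteq> {#}" "P \<noteq> unit"
    "forest_of s = {#Edge x (A \<odot> P)#}"
    and "t \<in> PT X" "forest_of t \<in> reduced_forests X" "s \<in> subterms t"
  shows "large_forest X (forest_of t)"
proof -
  have self: "large_forest X (forest_of s)"
    unfolding large_forest_def assms(5) using assms(1-4) by (auto simp: occurs_Edge)
  show ?thesis using assms(6-)
  proof (induction t rule: trm.induct)
    case (TPlus u v)
    have "forest_of u \<in> reduced_forests X" "forest_of v \<in> reduced_forests X"
      using TPlus.prems by (auto simp: reduced_forests_def distinct_forest_plus)
    with TPlus consider "s = u \<^bold>+ v" | "large_forest X (forest_of u)" | "large_forest X (forest_of v)" by auto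
    then show ?case
    proof cases
      case 1
      with self show ?thesis by simp
    qed (auto elim!: large_forest_mono)
  next
    case (TTimes u v)
    have u: "u \<in> monomial_terms X" "forest_of u \<in> forests X" "forest_of u \<noteq> {#}" and v: "forest_of v \<noteq> {#}"
      using TTimes.prems monomial_terms_PT[of u X]
      by (auto simp: forest_of_forests forest_of_PT_eq_empty[of _ X])
    have red: "forest_of v \<in> reduced_forests X" "forest_of u \<in> reduced_forests X"
      using monomial_times_reducedD[OF u(1) v] TTimes.prems(2) u(1) monomial_forests_reduced[of "forest_of u" X]
      by (auto simp flip: forest_of_monomial_terms)
    from TTimes.prems consider "s = u \<^bold>\<times> v" | "s \<in> subterms u" | "s \<in> subterms v" by auto
    then show ?case
    proof cases
      case 1
      with self show ?thesis by simp
    next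
      case 2
      then have "large_forest X (forest_of u)" using TTimes.IH(1) red u monomial_terms_PT by blast
      then show ?thesis using large_forest_times_right red v by simp
    next
      case 3
      then have "large_forest X (forest_of v)" using TTimes.IH(2) TTimes.prems red by simp
      then show ?thesis using large_forest_times_left u by simp
    qed
  qed (use self in auto)
qed

lemma large_poly_class:
  assumes Q: "Q \<in> reduced_forests X"
  shows "large X (poly_class X Q) \<longleftrightarrow> large_forest X Q"
proof
  assume "large X (poly_class X Q)"
  then obtain x ys p' where *: "x \<in> X" "ys \<noteq> []" "hd ys \<in> TVar ` X" "set ys \<subseteq> TVar ` X \<union> {\<^bold>1}"
    "distinct ys" "p' \<in> id_polynomials X - {[\<^bold>0]\<^sub>A\<^sub>C, [\<^bold>1]\<^sub>A\<^sub>C}"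
    "subpolynomial X ([TVar x]\<^sub>A\<^sub>C \<times>\<^sub>s\<^sub>b sb_sum (map (\<lambda>y. [y]\<^sub>A\<^sub>C \<times>\<^sub>s\<^sub>b p') ys)) (poly_class X Q)"
    unfolding large_def by blast
  then obtain P where P: "p' = poly_class X P" "P \<in> reduced_forests X" "P \<noteq> {#}" "P \<noteq> unit"
    unfolding id_polynomials_eq ac_class_const[of X] by blast
  define A where "A = sum_list (map forest_of ys)"
  have A: "A \<in> linear_forests X" unfolding A_def using * by (intro linear_forest_list)
  obtain s t where st: "s \<in> PT X" "t \<in> PT X" "forest_of t \<in> reduced_forests X"
    "poly_class X {#Edge x (A \<odot> P)#} = [s]\<^sub>A\<^sub>C" "poly_class X Q = [t]\<^sub>A\<^sub>C" "s \<in> subterms t"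
  proof -
    have "subpolynomial X (poly_class X {#Edge x (A \<odot> P)#}) (poly_class X Q)"
      using *(7) unfolding P(1) A_def
      by (subst (asm) large_pattern[OF *(1,4,2) reduced_forests_forests[OF P(2)] P(3)])
    then show ?thesis using that PT_id_iff unfolding subpolynomial_def by blast
  qed
  have "forest_of t = Q" using st Q ac_class_PT[of t X]
    by (simp add: poly_class_inject forest_of_forests reduced_forests_forests)
  moreover have "forest_of s = {#Edge x (A \<odot> P)#}"
  proof -
    have "A \<in> forests X" "A \<noteq> {#}" using A by (auto simp: linear_forests_def reduced_forests_forests)
    then have "{#Edge x (A \<odot> P)#} \<in> forests X"
      using *(1) P by (simp add: forests_times times_eq_empty reduced_forests_forests)
    then show ?thesis using st ac_class_PT[of s X] by (simp add: poly_class_inject forest_of_forests)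
  qed
  ultimately show "large_forest X Q" using large_subterm[OF A P(2-4), of s x t] st by blast
next
  assume large: "large_forest X Q"
  then obtain x A P where *: "A \<in> linear_forests X" "P \<in> reduced_forests X" "P \<noteq> {#}" "P \<noteq> unit"
    "occurs (Edge x (A \<odot> P)) Q"
    by (auto simp: large_forest_def)
  obtain ys where ys: "set ys \<subseteq> TVar ` X \<union> {\<^bold>1}" "distinct ys" "ys \<noteq> []" "hd ys \<in> TVar ` X"
    "sum_list (map forest_of ys) = A" using linear_forest_obtain_list[OF *(1)] by metis
  have b: "reduced_branch X (Edge x (A \<odot> P))" using occurs_reduced *(5) Q by metis
  then have x: "x \<in> X" by simp
  have Qf: "Q \<in> forests X" using Q by (rule reduced_forests_forests)
  have bf: "{#Edge x (A \<odot> P)#} \<in> forests X" using b by (rule reduced_branch_forests)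
  have "subpolynomial X (poly_class X {#Edge x (A \<odot> P)#}) (poly_class X Q)"
    unfolding subpolynomial_def
  proof (intro bexI conjI)
    show "poly_class X {#Edge x (A \<odot> P)#} = [nf {#Edge x (A \<odot> P)#}]\<^sub>A\<^sub>C" using bf by (rule poly_class_nf)
    show "poly_class X Q = [nf Q]\<^sub>A\<^sub>C" using Qf by (rule poly_class_nf)
    show "nf {#Edge x (A \<odot> P)#} \<in> subterms (nf Q)"
      using nf_subterm[OF *(5)] large_forest_ne[OF large] by simp
    show "nf Q \<in> PT_id X" using Qf Q by (simp add: PT_id_iff nf_PT forest_of_nf[of Q X])
    show "nf {#Edge x (A \<odot> P)#} \<in> PT_id X"
      using bf b by (simp add: PT_id_iff nf_PT forest_of_nf[of _ X] del: nf_single)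
  qed
  moreover have "poly_class X Q \<noteq> [\<^bold>0]\<^sub>A\<^sub>C" "poly_class X Q \<noteq> [\<^bold>1]\<^sub>A\<^sub>C" "poly_class X P \<noteq> [\<^bold>0]\<^sub>A\<^sub>C" "poly_class X P \<noteq> [\<^bold>1]\<^sub>A\<^sub>C"
    using Qf large_forest_ne[OF large] * unfolding ac_class_const[of X]
    by (simp_all add: poly_class_inject reduced_forests_forests forests.empty forests.Leaf)
  moreover have "poly_class X Q \<in> id_polynomials X" "poly_class X P \<in> id_polynomials X"
    using Q *(2) unfolding id_polynomials_eq by blast+
  ultimately show "large X (poly_class X Q)"
    unfolding large_def
    using x ys large_pattern[OF x ys(1,3) reduced_forests_forests[OF *(2)] *(3)]
    by (intro conjI exI[of _ x] exI[of _ ys] exI[of _ "poly_class X P"]) simp_all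
qed

section \<open>The quotient by the large polynomials\<close>

definition quot_class :: "'a set \<Rightarrow> 'a forest \<Rightarrow> 'a trm set set" where
  "quot_class X P = large_rel X `` {poly_class X P}"

lemma large_rel_poly_class:
  "P \<in> reduced_forests X \<Longrightarrow> Q \<in> reduced_forests X \<Longrightarrow>
    (poly_class X P, poly_class X Q) \<in> large_rel X \<longleftrightarrow> P = Q \<or> large_forest X P \<and> large_forest X Q"
  by (auto simp: large_rel_def large_poly_class id_polynomials_eq poly_class_inject reduced_forests_forests)

lemma quot_class_eq:
  assumes "P \<in> reduced_forests X"
  shows "quot_class X P =
    poly_class X ` {Q \<in> reduced_forests X. P = Q \<or> large_forest X P \<and> large_forest X Q}"
proof -
  have "quot_class X P \<subseteq> poly_class X ` reduced_forests X"
    by (auto simp: quot_class_def large_rel_def id_polynomials_eq)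
  then show ?thesis
    using assms large_rel_poly_class[OF assms] by (auto simp: quot_class_def)
qed

lemma quot_class_eq_iff:
  assumes "P \<in> reduced_forests X" "Q \<in> reduced_forests X"
  shows "quot_class X P = quot_class X Q \<longleftrightarrow> P = Q \<or> large_forest X P \<and> large_forest X Q"
proof
  assume "quot_class X P = quot_class X Q"
  moreover have "poly_class X Q \<in> quot_class X Q" using assms by (auto simp: quot_class_eq)
  ultimately have "(poly_class X P, poly_class X Q) \<in> large_rel X"
    unfolding quot_class_def by blast
  with assms show "P = Q \<or> large_forest X P \<and> large_forest X Q" by (simp add: large_rel_poly_class)
next
  assume "P = Q \<or> large_forest X P \<and> large_forest X Q"
  then show "quot_class X P = quot_class X Q"
    unfolding quot_class_eq[OF assms(1)] quot_class_eq[OF assms(2)] by auto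
qed

text \<open>The operations of the quotient are unions over representatives. If changing one argument within the
  large forests leaves the class of the result unchanged, then all members of the union agree.\<close>

lemma quot_class_Union:
  assumes P: "P \<in> reduced_forests X" and Q: "Q \<in> reduced_forests X"
    and f: "\<And>P Q. P \<in> reduced_forests X \<Longrightarrow> Q \<in> reduced_forests X \<Longrightarrow>
      f (poly_class X P) (poly_class X Q) = poly_class X (g P Q) \<and> g P Q \<in> reduced_forests X"
    and cong: "\<And>P P' Q. P \<in> reduced_forests X \<Longrightarrow> P' \<in> reduced_forests X \<Longrightarrow> Q \<in> reduced_forests X \<Longrightarrow>
      large_forest X P \<Longrightarrow> large_forest X P' \<Longrightarrow> quot_class X (g P Q) = quot_class X (g P' Q)"
      "\<And>P Q Q'. P \<in> reduced_forests X \<Longrightarrow> Q \<in> reduced_forests X \<Longrightarrow> Q' \<in> reduced_forests X \<Longrightarrow>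
      large_forest X Q \<Longrightarrow> large_forest X Q' \<Longrightarrow> quot_class X (g P Q) = quot_class X (g P Q')"
  shows "(\<Union>p\<in>quot_class X P. \<Union>q\<in>quot_class X Q. large_rel X `` {f p q}) = quot_class X (g P Q)"
proof -
  have "large_rel X `` {f p q} = quot_class X (g P Q)" if p: "p \<in> quot_class X P" and q: "q \<in> quot_class X Q" for p q
  proof -
    obtain P' where P': "p = poly_class X P'" "P' \<in> reduced_forests X" "P = P' \<or> large_forest X P \<and> large_forest X P'"
      using p P by (auto simp: quot_class_eq)
    obtain Q' where Q': "q = poly_class X Q'" "Q' \<in> reduced_forests X" "Q = Q' \<or> large_forest X Q \<and> large_forest X Q'"
      using q Q by (auto simp: quot_class_eq)
    have "large_rel X `` {f p q} = quot_class X (g P' Q')"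
      using f P' Q' by (simp add: quot_class_def)
    also have "\<dots> = quot_class X (g P Q')" using cong(1)[of P P' Q'] P P' Q' by auto
    also have "\<dots> = quot_class X (g P Q)" using cong(2)[of P Q Q'] P Q Q' by auto
    finally show ?thesis .
  qed
  moreover have "poly_class X P \<in> quot_class X P" "poly_class X Q \<in> quot_class X Q"
    using P Q by (auto simp: quot_class_eq)
  ultimately show ?thesis by blast
qed

lemma M_carrier: "carrier (M_bimonoid X) = quot_class X ` reduced_forests X"
  by (auto simp: M_bimonoid_def quotient_bimonoid_def B_id_rd_def id_polynomials_eq quotient_def quot_class_def)

lemma M_zero: "\<zero>\<^bsub>M_bimonoid X\<^esub> = quot_class X {#}"
  by (simp add: M_bimonoid_def quotient_bimonoid_def B_id_rd_def quot_class_def ac_class_const[of X])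

lemma M_one: "\<one>\<^bsub>M_bimonoid X\<^esub> = quot_class X unit"
  by (simp add: M_bimonoid_def quotient_bimonoid_def B_id_rd_def quot_class_def ac_class_const[of X])

text \<open>A union with a large forest is large, so both sides of the congruence condition are large.\<close>

lemma M_add:
  assumes "P \<in> reduced_forests X" "Q \<in> reduced_forests X"
  shows "quot_class X P \<oplus>\<^bsub>M_bimonoid X\<^esub> quot_class X Q = quot_class X (P \<union># Q)"
proof -
  have large: "quot_class X (P \<union># Q) = quot_class X (P' \<union># Q')"
    if "P \<in> reduced_forests X" "P' \<in> reduced_forests X" "Q \<in> reduced_forests X" "Q' \<in> reduced_forests X"
      "large_forest X P \<and> large_forest X P' \<or> large_forest X Q \<and> large_forest X Q'"
    for P P' Q Q'
    using that by (subst quot_class_eq_iff) (auto simp: reduced_forests_sup elim: large_forest_mono)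
  have "quot_class X P \<oplus>\<^bsub>M_bimonoid X\<^esub> quot_class X Q =
      (\<Union>p\<in>quot_class X P. \<Union>q\<in>quot_class X Q. large_rel X `` {id_plus X p q})"
    by (simp add: M_bimonoid_def quotient_bimonoid_def B_id_rd_def)
  also have "\<dots> = quot_class X (P \<union># Q)"
    using assms
    by (rule quot_class_Union)
      ((simp add: id_plus_poly_class reduced_forests_sup; fail) | (rule large; simp))+
  finally show ?thesis .
qed

text \<open>A product with a large factor is large, unless the other factor is \<open>0\<close> and the product is \<open>0\<close>.\<close>

lemma M_mult:
  assumes "P \<in> reduced_forests X" "Q \<in> reduced_forests X"
  shows "quot_class X P \<otimes>\<^bsub>M_bimonoid X\<^esub> quot_class X Q = quot_class X (P \<odot> Q)"
proof -
  have right: "quot_class X (P \<odot> Q) = quot_class X (P' \<odot> Q)"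
    if "P \<in> reduced_forests X" "P' \<in> reduced_forests X" "Q \<in> reduced_forests X"
      "large_forest X P" "large_forest X P'" for P P' Q
    using that by (cases "Q = {#}") (simp_all add: quot_class_eq_iff reduced_forests_times large_forest_times_right)
  have left: "quot_class X (P \<odot> Q) = quot_class X (P \<odot> Q')"
    if "P \<in> reduced_forests X" "Q \<in> reduced_forests X" "Q' \<in> reduced_forests X"
      "large_forest X Q" "large_forest X Q'" for P Q Q'
    using that by (cases "P = {#}")
      (simp_all add: quot_class_eq_iff reduced_forests_times large_forest_times_left reduced_forests_forests)
  have "quot_class X P \<otimes>\<^bsub>M_bimonoid X\<^esub> quot_class X Q =
      (\<Union>p\<in>quot_class X P. \<Union>q\<in>quot_class X Q. large_rel X `` {rd_times X p q})"
    by (simp add: M_bimonoid_def quotient_bimonoid_def B_id_rd_def)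
  also have "\<dots> = quot_class X (P \<odot> Q)"
    using assms
    by (rule quot_class_Union)
      ((simp add: rd_times_poly_class reduced_forests_times reduced_forests_forests; fail)
        | (rule left; simp; fail) | (rule right; simp))+
  finally show ?thesis .
qed

lemma times_sup_left:
  assumes "P \<in> reduced_forests X" "Q \<in> reduced_forests X" "R \<in> reduced_forests X"
  shows "(P \<union># Q) \<odot> R = (P \<odot> R) \<union># (Q \<odot> R)"
proof (rule distinct_forest_eqI)
  show "distinct_forest ((P \<union># Q) \<odot> R)" "distinct_forest ((P \<odot> R) \<union># (Q \<odot> R))"
    using assms by (simp_all add: distinct_forest_times[of _ X] reduced_forests_sup)
  show "set_mset ((P \<union># Q) \<odot> R) = set_mset ((P \<odot> R) \<union># (Q \<odot> R))"
    by (simp add: forest_times_def image_Un)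
qed

lemma M_strong_bimonoid: "strong_bimonoid (M_bimonoid X)"
proof -
  have "abelian_monoid (M_bimonoid X)"
    by (rule abelian_monoidI)
      (auto simp: M_carrier M_zero M_add reduced_forests_sup subset_mset.sup_assoc subset_mset.sup_commute
        subset_mset.sup_left_commute)
  moreover have "monoid (M_bimonoid X)"
    by (intro monoidI)
      (auto simp: M_carrier M_one M_mult reduced_forests_times forest_times_assoc
        times_unit_right[of _ X] reduced_forests_forests)
  moreover have "strong_bimonoid_axioms (M_bimonoid X)"
    by unfold_locales (auto simp: M_carrier M_zero M_mult)
  ultimately show ?thesis by (rule strong_bimonoid.intro)
qed

lemma M_idempotent: "idempotent_bimonoid (M_bimonoid X)"
  by (auto simp: idempotent_bimonoid_def M_carrier M_add)

lemma M_right_distributive: "right_distributive (M_bimonoid X)"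
  by (auto simp: right_distributive_def M_carrier M_add M_mult reduced_forests_sup reduced_forests_times times_sup_left)

section \<open>Weak local finiteness\<close>

text \<open>The sum of a finite set of id-reduced polynomials.\<close>

definition forest_Union :: "'a forest set \<Rightarrow> 'a forest" where
  "forest_Union S = mset_set (\<Union>P\<in>S. set_mset P)"

lemma forest_Union_empty [simp]: "forest_Union {} = {#}"
  by (simp add: forest_Union_def)

lemma set_mset_forest_Union: "finite S \<Longrightarrow> set_mset (forest_Union S) = (\<Union>P\<in>S. set_mset P)"
  by (simp add: forest_Union_def)

lemma distinct_forest_mset_set: "distinct_forest (mset_set A)"
  by (cases "finite A") (auto simp: distinct_forest_def count_mset_set')

lemma forest_Union_reduced:
  "finite S \<Longrightarrow> S \<subseteq> reduced_forests X \<Longrightarrow> forest_Union S \<in> reduced_forests X"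
  by (auto simp: reduced_forests_def set_mset_forest_Union) (simp add: forest_Union_def distinct_forest_mset_set)

lemma forest_Union_Un:
  assumes "finite S" "finite T"
  shows "forest_Union (S \<union> T) = forest_Union S \<union># forest_Union T"
proof (rule distinct_forest_eqI)
  show "distinct_forest (forest_Union (S \<union> T))" "distinct_forest (forest_Union S \<union># forest_Union T)"
    by (simp_all add: forest_Union_def distinct_forest_mset_set)
qed (use assms in \<open>auto simp: set_mset_forest_Union\<close>)

lemma forest_Union_single: "P \<in> reduced_forests X \<Longrightarrow> forest_Union {P} = P"
  by (rule distinct_forest_eqI) (auto simp: reduced_forests_def forest_Union_def distinct_forest_mset_set)

text \<open>The set \<open>G\<close> consists of the products of at most two elements of \<open>F\<close>, of \<open>0\<close>, and of one
  large element \<open>L\<close> that stands for all longer products of factors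
  different from \<open>0\<close> and \<open>1\<close>.\<close>

lemma finite_products_mod_large:
  assumes "finite F" "F \<subseteq> reduced_forests X" "X \<noteq> {}"
  obtains G where "finite G" "G \<subseteq> reduced_forests X" "{#} \<in> G" "unit \<in> G" "F \<subseteq> G"
    "\<And>P Q. P \<in> G \<Longrightarrow> Q \<in> F \<Longrightarrow> \<exists>R\<in>G. quot_class X (P \<odot> Q) = quot_class X R"
proof -
  obtain x where x: "x \<in> X" using assms(3) by blast
  \<comment> \<open>Any triple product is large; this one is available over every nonempty \<open>X\<close>.\<close>
  define L where "L = {#Edge x unit#} \<odot> ({#Edge x unit#} \<odot> {#Edge x unit#})"
  have L: "L \<in> reduced_forests X" "large_forest X L"
    using x unfolding L_def by (auto intro!: reduced_forests_times large_triple_product)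
  define G where "G = {{#}, unit, L} \<union> F \<union> (\<lambda>(P, Q). P \<odot> Q) ` (F \<times> F)"
  have red: "P \<odot> Q \<in> reduced_forests X" if "P \<in> F" "Q \<in> F" for P Q
    using that assms(2) by (auto intro: reduced_forests_times)
  have f: "P \<odot> unit = P" if "P \<in> reduced_forests X" for P
    using that by (auto intro: times_unit_right reduced_forests_forests)
  have prod: "\<exists>R\<in>G. quot_class X (P \<odot> Q) = quot_class X R" if P: "P \<in> G" and Q: "Q \<in> F" for P Q
  proof -
    have QX: "Q \<in> reduced_forests X" using Q assms(2) by blast
    have large: ?thesis if "large_forest X (P \<odot> Q)" "P \<in> reduced_forests X"
      using that L QX by (intro bexI[of _ L]) (auto simp: quot_class_eq_iff reduced_forests_times G_def)
    have eq: ?thesis if "P \<odot> Q \<in> G" using that by blast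
    consider "P = {#} \<or> P = unit \<or> P \<in> F \<or> Q = {#}" | "P = L" "Q \<noteq> {#}"
      | A B where "P = A \<odot> B" "A \<in> F" "B \<in> F" "Q \<noteq> {#}"
      using P unfolding G_def by auto
    then show ?thesis
    proof cases
      case 1
      then show ?thesis using Q by (intro eq) (auto simp: G_def)
    next
      case 2
      then show ?thesis using L QX by (intro large) (auto intro: large_forest_times_right)
    next
      case 3
      have AB: "A \<in> reduced_forests X" "B \<in> reduced_forests X" using 3 assms(2) by auto
      show ?thesis
      proof (cases "A \<in> {{#}, unit} \<or> B \<in> {{#}, unit} \<or> Q = unit")
        case True
        \<comment> \<open>A factor \<open>0\<close> or \<open>1\<close> reduces the triple product to a product of at most two elements of \<open>F\<close>.\<close>
        then have "P \<odot> Q \<in> {{#}, B \<odot> Q, A \<odot> Q, A \<odot> B}"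
          using f AB by (auto simp: 3(1) forest_times_assoc)
        then have "P \<odot> Q \<in> G" using 3(2,3) Q by (auto simp: G_def)
        then show ?thesis by (rule eq)
      next
        case False
        then have "large_forest X (P \<odot> Q)"
          using large_triple_product[of A X B Q] AB QX 3 by (auto simp: forest_times_assoc)
        then show ?thesis using large red 3 by blast
      qed
    qed
  qed
  show ?thesis
  proof (rule that[of G])
    show "finite G" using assms(1) by (simp add: G_def)
    show "G \<subseteq> reduced_forests X" using assms(2) L red by (auto simp: G_def)
  qed (use prod in \<open>auto simp: G_def\<close>)
qed

text \<open>The classes of the sums of subsets of \<open>G\<close> contain the generators and are closed under addition,
  as a sum of two such sums is the sum of the union. They are closed under multiplication by a
  generator from the right, because it distributes over the sum and maps each element of \<open>G\<close> to an
  element of \<open>G\<close>, up to \<open>\<sim>\<^sub>L\<close>.\<close>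

lemma M_weakly_locally_finite:
  assumes "X \<noteq> {}"
  shows "weakly_locally_finite (M_bimonoid X)"
  unfolding weakly_locally_finite_def
proof (intro allI impI)
  fix A assume "A \<subseteq> carrier (M_bimonoid X)" "finite A"
  then obtain F where F: "F \<subseteq> reduced_forests X" "finite F" "A = quot_class X ` F"
    unfolding M_carrier by (meson finite_subset_image)
  obtain G where G: "finite G" "G \<subseteq> reduced_forests X" "{#} \<in> G" "unit \<in> G" "F \<subseteq> G"
    and prod: "\<And>P Q. P \<in> G \<Longrightarrow> Q \<in> F \<Longrightarrow> \<exists>R\<in>G. quot_class X (P \<odot> Q) = quot_class X R"
    using finite_products_mod_large[OF F(2,1) assms] by metis
  define W where "W = (\<lambda>S. quot_class X (forest_Union S)) ` Pow G"
  have fin: "finite S" if "S \<subseteq> G" for S using that G(1) finite_subset by blast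
  have red: "forest_Union S \<in> reduced_forests X" if "S \<subseteq> G" for S
    using that fin G(2) by (intro forest_Union_reduced) auto
  have single: "quot_class X P \<in> W" if "P \<in> G" for P
    unfolding W_def using that G(2) forest_Union_single[of P X] by (intro image_eqI[of _ _ "{P}"]) auto
  have closed: "quot_class X (forest_Union S \<odot> Q) \<in> W" if S: "S \<subseteq> G" and QF: "Q \<in> F" for S Q
  proof -
    have Q: "Q \<in> reduced_forests X" using QF F by blast
    have "finite S" using S fin by blast
    then show ?thesis using S
    proof (induction S)
      case empty
      then show ?case using single[of "{#}"] G by simp
    next
      case (insert P S)
      then obtain T where T: "T \<subseteq> G" "quot_class X (forest_Union S \<odot> Q) = quot_class X (forest_Union T)"
        unfolding W_def by auto
      obtain R where R: "R \<in> G" "quot_class X (P \<odot> Q) = quot_class X R"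
        using prod[of P Q] insert.prems QF by auto
      have P: "P \<in> reduced_forests X" "R \<in> reduced_forests X" using insert.prems R G by auto
      have S: "forest_Union S \<in> reduced_forests X" using insert.prems red by simp
      have "forest_Union (insert P S) = P \<union># forest_Union S"
        using forest_Union_Un[of "{P}" S] insert.hyps forest_Union_single[OF P(1)] by simp
      then have "quot_class X (forest_Union (insert P S) \<odot> Q) =
          quot_class X ((P \<odot> Q) \<union># (forest_Union S \<odot> Q))"
        using P S Q by (simp add: times_sup_left)
      also have "\<dots> = quot_class X (P \<odot> Q) \<oplus>\<^bsub>M_bimonoid X\<^esub> quot_class X (forest_Union S \<odot> Q)"
        using P S Q by (simp add: M_add reduced_forests_times)
      also have "\<dots> = quot_class X (R \<union># forest_Union T)"
        unfolding R T using P T red by (simp add: M_add)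
      also have "R \<union># forest_Union T = forest_Union (insert R T)"
        using forest_Union_Un[of "{R}" T] fin T forest_Union_single[OF P(2)] by simp
      finally show ?case unfolding W_def using R T by blast
    qed
  qed
  have "weak_closure (M_bimonoid X) A \<subseteq> W"
  proof
    fix c assume "c \<in> weak_closure (M_bimonoid X) A"
    then show "c \<in> W"
    proof (induction rule: weak_closure.induct)
      case (incl c)
      then show ?case using single F(3) G(5) by blast
    next
      case zero
      then show ?case using single G(3) by (simp add: M_zero)
    next
      case one
      then show ?case using single G(4) by (simp add: M_one)
    next
      case (add b c)
      then obtain S T where "S \<subseteq> G" "b = quot_class X (forest_Union S)" "T \<subseteq> G" "c = quot_class X (forest_Union T)"
        unfolding W_def by blast
      then show ?case unfolding W_def using red fin
        by (intro image_eqI[of _ _ "S \<union> T"]) (simp_all add: M_add forest_Union_Un)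
    next
      case (mult b a)
      then obtain S Q where "S \<subseteq> G" "b = quot_class X (forest_Union S)" "Q \<in> F" "a = quot_class X Q"
        unfolding W_def using F(3) by blast
      then show ?case using closed red F(1) by (simp add: M_mult subset_iff)
    qed
  qed
  moreover have "finite W" using G(1) by (simp add: W_def)
  ultimately show "finite (weak_closure (M_bimonoid X) A)" by (rule finite_subset)
qed

section \<open>An infinite finitely generated subalgebra\<close>

text \<open>The forest of \<open>1 + x \<times> (1 + x \<times> (\<dots> \<times> (1 + x)))\<close> with \<open>n\<close> occurrences of \<open>x\<close>,
  and of \<open>1\<close> for \<open>n = 0\<close>.\<close>

primrec comb :: "'a \<Rightarrow> nat \<Rightarrow> 'a forest" where
  "comb x 0 = unit"
| "comb x (Suc n) = {#Leaf, Edge x (comb x n)#}"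

lemma comb_ne_empty [simp]: "comb x n \<noteq> {#}"
  by (cases n) auto

lemma comb_reduced: "x \<in> X \<Longrightarrow> comb x n \<in> reduced_forests X"
  by (induction n) (auto simp: reduced_forests_def)

lemma weight_comb: "weight (comb x n) = 2 * n + 1"
proof (induction n)
  case (Suc n)
  then show ?case using weight_add_mset[of Leaf "{#Edge x (comb x n)#}"] by simp
qed simp

lemma comb_inject [simp]: "comb x m = comb x n \<longleftrightarrow> m = n"
proof
  assume "comb x m = comb x n"
  then have "weight (comb x m) = weight (comb x n)" by simp
  then show "m = n" by (simp add: weight_comb)
qed simp

lemma occurs_comb: "occurs (Edge y P) (comb x n) \<Longrightarrow> \<exists>k. P = comb x k"
proof (induction n)
  case (Suc n)
  then show ?case
    using occurs_add_mset[of "Edge y P" Leaf "{#Edge x (comb x n)#}"]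
    by (auto simp: occurs_Leaf occurs_Edge)
qed (simp add: occurs_Leaf)

text \<open>In a comb, a pattern \<open>A \<odot> P\<close> would be a comb \<open>1 + x \<times> P\<close>. As it contains \<open>1\<close>, the linear
  forest \<open>A\<close> contains \<open>1\<close> too, so all summands of \<open>P\<close> are among \<open>1\<close> and \<open>x \<times> P\<close>. But \<open>P\<close> is itself a
  comb \<open>1 + x \<times> P'\<close> with a shorter comb \<open>P'\<close>, so that \<open>x \<times> P'\<close> is different from both.\<close>

lemma comb_not_large: "\<not> large_forest X (comb x n)"
proof
  assume "large_forest X (comb x n)"
  then obtain y A P where A: "A \<in> linear_forests X" and P: "P \<in> reduced_forests X" "P \<noteq> {#}" "P \<noteq> unit"
    and occ: "occurs (Edge y (A \<odot> P)) (comb x n)"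
    by (auto simp: large_forest_def)
  then obtain k where k: "A \<odot> P = comb x k" using occurs_comb by metis
  have Ar: "A \<in> reduced_forests X" "A \<noteq> {#}" "A \<noteq> unit" using A by (auto simp: linear_forests_def)
  then have "A \<odot> P \<noteq> unit" by (intro times_ne_unit)
  then obtain j where j: "k = Suc j" using k by (cases k) auto
  \<comment> \<open>Both \<open>A \<odot> P\<close> and, by its branch \<open>Edge z P\<close>, also \<open>P\<close> are combs.\<close>
  note AP = in_times_iff[OF reduced_forests_forests[OF Ar(1)] P(2)]
  obtain z Q where "Edge z Q \<in># A" using reduced_has_Edge[OF Ar] by metis
  then have "Edge z unit \<in># A" using A by (auto simp: linear_forests_def)
  then have "Edge z P \<in># A \<odot> P" unfolding AP by force
  then have Pj: "P = comb x j" unfolding k j by simp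
  have "Leaf \<in># A \<odot> P" unfolding k j by simp
  then have "Leaf \<in># A" unfolding AP by blast
  obtain i where i: "j = Suc i" using Pj P by (cases j) auto
  then have "Edge x (comb x i) \<in># P" unfolding Pj by simp
  with \<open>Leaf \<in># A\<close> have "Edge x (comb x i) \<in># A \<odot> P" unfolding AP by blast
  then have "comb x i = comb x (Suc i)" unfolding k j i by simp
  then show False unfolding comb_inject by simp
qed

lemma M_not_locally_finite:
  assumes "X \<noteq> {}"
  shows "\<not> locally_finite (M_bimonoid X)"
proof
  assume lf: "locally_finite (M_bimonoid X)"
  obtain x where x: "x \<in> X" using assms by blast
  define A where "A = {quot_class X {#Edge x unit#}}"
  have "A \<subseteq> carrier (M_bimonoid X)" using x by (auto simp: A_def M_carrier)
  then have fin: "finite (bimonoid_closure (M_bimonoid X) A)"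
    using lf by (simp add: locally_finite_def A_def)
  have mem: "quot_class X (comb x n) \<in> bimonoid_closure (M_bimonoid X) A" for n
  proof (induction n)
    case 0
    show ?case using bimonoid_closure.one[of "M_bimonoid X" A] by (simp add: M_one)
  next
    case (Suc n)
    have "quot_class X unit \<oplus>\<^bsub>M_bimonoid X\<^esub>
        (quot_class X {#Edge x unit#} \<otimes>\<^bsub>M_bimonoid X\<^esub> quot_class X (comb x n))
        \<in> bimonoid_closure (M_bimonoid X) A"
      using Suc bimonoid_closure.one[of "M_bimonoid X" A]
      by (auto simp: A_def M_one intro!: bimonoid_closure.add bimonoid_closure.mult intro: bimonoid_closure.incl)
    also have "quot_class X {#Edge x unit#} \<otimes>\<^bsub>M_bimonoid X\<^esub> quot_class X (comb x n) =
        quot_class X {#Edge x (comb x n)#}"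
      using x by (simp add: M_mult comb_reduced times_Edge graft_def)
    also have "quot_class X unit \<oplus>\<^bsub>M_bimonoid X\<^esub> quot_class X {#Edge x (comb x n)#} =
        quot_class X (unit \<union># {#Edge x (comb x n)#})"
      using x by (simp add: M_add comb_reduced)
    \<comment> \<open>The next comb is \<open>1 + x \<times> comb x n\<close>.\<close>
    also have "unit \<union># {#Edge x (comb x n)#} = comb x (Suc n)"
      by (rule distinct_forest_eqI) auto
    finally show ?case .
  qed
  have "inj (\<lambda>n. quot_class X (comb x n))"
    using x by (auto intro!: injI simp: quot_class_eq_iff comb_reduced comb_not_large)
  then have "infinite (range (\<lambda>n. quot_class X (comb x n)))" 
    using finite_imageD infinite_UNIV_nat by blast
  moreover have "range (\<lambda>n. quot_class X (comb x n)) \<subseteq> bimonoid_closure (M_bimonoid X) A"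
    using mem by blast
  ultimately show False using fin finite_subset by blast
qed

theorem theorem7p8:
  fixes X :: "'a set"
  assumes "X \<noteq> {}"
  shows "strong_bimonoid (M_bimonoid X) \<and> idempotent_bimonoid (M_bimonoid X) \<and>
    right_distributive (M_bimonoid X) \<and> weakly_locally_finite (M_bimonoid X) \<and>
    \<not> locally_finite (M_bimonoid X)"
  using M_strong_bimonoid M_idempotent M_right_distributive M_weakly_locally_finite[OF assms]
    M_not_locally_finite[OF assms] by (intro conjI)

end
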